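(* Let $\{T_1,T_2\}$ be a dual pair of symmetric contractions in $\mathfrak H=\mathfrak H_1\oplus\mathfrak H_2$, with blocks $T_{11}=T_{11}^*$, $T_{21}=VD_{T_{11}}$, $T_{12}=D_{T_{11}}U$, let $\varphi\in(0,\pi/2]$, and let $\mathcal H_1:=\overline{\mathrm{ran}}(D_U)$, $\mathcal H_2:=\overline{\mathrm{ran}}(D_{V^*})$. Then: (i) the set $\mathrm{Ext}_{\{T_1,T_2\}}(\varphi)$ is nonempty if and only if $\varphi\in[\varphi_1,\pi/2]$, where $\varphi_1:=\arccos\bigl(\|D_{V^*}^{-1}(I-VU)D_U^{-1}\|^{-1}\bigr)$; (ii) for any $\varphi\in[\varphi_1,\pi/2]$ ($\varphi>0$) and any operator $T=\begin{pmatrix}T_{11}&T_{12}\\ T_{21}&T_{22}\end{pmatrix}$ with $T_{22}\in[\mathfrak H_2]$, one has $T\in\mathrm{Ext}_{\{T_1,T_2\}}(\varphi)$ if and only if $$T_{22}=-VT_{11}U+D_{V^*}KD_U$$ for some $K\in[\mathcal H_1,\mathcal H_2]$ such that both operators $K\sin\varphi+ iQ\cos\varphi$ and $K\sin\varphi- iQ\cos\varphi$ are contractions, where $Q$ is the closure of $Q_0=D_{V^*}^{-1}(I-VU)D_U^{-1}$; (iii) for $\varphi\in[\varphi_1,\pi/2]$ ($\varphi>0$) the set $\mathrm{Ext}_{\{T_1,T_2\}}(\varphi)$ consists of one element if at least one of the following conditions is satisfied: (a) $D_{V^*}=0$; (b) $D_U=0$; (c) $Q\cos\varphi$ is a maximal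 partial isometry.
   Context: Hilbert spaces are complex and separable; $[\mathfrak H,\mathfrak K]$ denotes the bounded operators from $\mathfrak H$ to $\mathfrak K$, $[\mathfrak H]=[\mathfrak H,\mathfrak H]$. For a contraction $X$, $D_X:=(I-X^*X)^{1/2}$. A dual pair of symmetric contractions in $\mathfrak H=\mathfrak H_1\oplus\mathfrak H_2$ is a pair of contractions $T_1,T_2\in[\mathfrak H_1,\mathfrak H]$ with $(T_1f,g)=(f,T_2g)$ and $(T_jf,g)=(f,T_jg)$ for $f,g\in\mathfrak H_1$. Equivalently $T_1=\binom{T_{11}}{T_{21}}$, $T_2=\binom{T_{11}}{T_{12}^*}$ with $T_{11}=T_{11}^*\in[\mathfrak H_1]$, $T_{21}=VD_{T_{11}}$, $T_{12}=D_{T_{11}}U$, where $V\in[\mathfrak H_1,\mathfrak H_2]$, $U\in[\mathfrak H_2,\mathfrak H_1]$ are the contractions uniquely determined by additionally requiring $\ker V\supset\ker D_{T_{11}}$ and $\ker U^*\supset\ker D_{T_{11}}$. An extension of $\{T_1,T_2\}$ is $T\in[\mathfrak H]$ with $T|_{\mathfrak H_1}=T_1$ and $T^*|_{\mathfrak H_1}=T_2$, i.e. a block matrix $T=(T_{ij})$ with the given $T_{11},T_{12},T_{21}$. For $\varphi\in(0,\pi/2]$, $C_{\mathfrak H}(\varphi)$ is the set of $T\in[\mathfrak H]$ with $\|T\sin\varphi+i\cos\varphi\, I\|\le1$ and $\|T\sin\varphi-i\cos\varphi\, I\|\le1$. $\mathrm{Ext}_{\{T_1,T_2\}}(\varphi)$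 is the set of extensions of $\{T_1,T_2\}$ belonging to $C_{\mathfrak H}(\varphi)$. Conventions on $Q_0$: $Q_0$ is called bounded if there is a bounded operator $Q\in[\mathcal H_1,\mathcal H_2]$ with $I-VU=D_{V^*}QD_U$ on $\mathfrak H_2$; then $Q$ is unique, is the closure of $Q_0$, and $\|Q_0\|=\|Q\|$. Otherwise $Q_0$ is unbounded, $\|Q_0\|^{-1}:=0$ and $\varphi_1=\pi/2$; for $\varphi=\pi/2$ the operator $Q\cos\varphi$ is always read as $0$. If $Q_0$ is bounded and $\mathcal H_1=\{0\}$ or $\mathcal H_2=\{0\}$, then $\varphi_1:=0$. A maximal partial isometry $X\in[\mathcal H_1,\mathcal H_2]$ is one with $X^*X=I_{\mathcal H_1}$ or $XX^*=I_{\mathcal H_2}$. *)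

theory Defs
  imports "HOL-Analysis.Analysis"
begin

text \<open>The inner product is linear in its first argument.  Norm, topology and positive definiteness
  are those of \<open>real_inner\<close>, tied to \<open>cinner\<close> by \<open>Re_cinner\<close>.  The trivial space is allowed.\<close>

class complex_inner = real_inner +
  fixes scaleC :: "complex \<Rightarrow> 'a \<Rightarrow> 'a"  (infixr "*\<^sub>C" 75)
    and cinner :: "'a \<Rightarrow> 'a \<Rightarrow> complex"
  assumes scaleC_add_right: "scaleC a (x + y) = scaleC a x + scaleC a y"
    and scaleC_add_left: "scaleC (a + b) x = scaleC a x + scaleC b x"
    and scaleC_scaleC: "scaleC a (scaleC b x) = scaleC (a * b) x"
    and scaleR_scaleC: "scaleR r x = scaleC (complex_of_real r) x"
    and cinner_commute: "cinner x y = cnj (cinner y x)"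
    and cinner_add_left: "cinner (x + y) z = cinner x z + cinner y z"
    and cinner_scaleC_left: "cinner (scaleC a x) y = a * cinner x y"
    and Re_cinner: "Re (cinner x y) = inner x y"

class complex_hilbert = complex_inner + complete_space

text \<open>The product type is the orthogonal sum: the library's norm on pairs is the \<open>l\<^sup>2\<close> norm.\<close>

instantiation prod :: (complex_inner, complex_inner) complex_inner
begin

definition scaleC_prod :: "complex \<Rightarrow> 'a \<times> 'b \<Rightarrow> 'a \<times> 'b"
  where "scaleC_prod a x = (a *\<^sub>C fst x, a *\<^sub>C snd x)"

definition cinner_prod :: "'a \<times> 'b \<Rightarrow> 'a \<times> 'b \<Rightarrow> complex"
  where "cinner_prod x y = cinner (fst x) (fst y) + cinner (snd x) (snd y)"

instance
proof
  fix a b :: complex and r :: real and x y z :: "'a \<times> 'b"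
  show "a *\<^sub>C (x + y) = a *\<^sub>C x + a *\<^sub>C y"
    by (simp add: scaleC_prod_def scaleC_add_right)
  show "(a + b) *\<^sub>C x = a *\<^sub>C x + b *\<^sub>C x"
    by (simp add: scaleC_prod_def scaleC_add_left)
  show "a *\<^sub>C b *\<^sub>C x = (a * b) *\<^sub>C x"
    by (simp add: scaleC_prod_def scaleC_scaleC)
  show "r *\<^sub>R x = complex_of_real r *\<^sub>C x"
    by (simp add: scaleC_prod_def scaleR_prod_def scaleR_scaleC)
  show "cinner x y = cnj (cinner y x)"
    by (simp add: cinner_prod_def cinner_commute [symmetric])
  show "cinner (x + y) z = cinner x z + cinner y z"
    by (simp add: cinner_prod_def cinner_add_left)
  show "cinner (a *\<^sub>C x) y = a * cinner x y"
    by (simp add: cinner_prod_def scaleC_prod_def cinner_scaleC_left distrib_left)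
  show "Re (cinner x y) = inner x y"
    by (simp add: cinner_prod_def inner_prod_def Re_cinner)
qed

end

instance prod :: (complex_hilbert, complex_hilbert) complex_hilbert ..

text \<open>\<open>bounded_ops S R\<close> is the set of bounded complex-linear operators from the closed subspace \<open>S\<close>
  to the closed subspace \<open>R\<close>; values outside \<open>S\<close> are irrelevant.\<close>

definition bounded_ops ::
  "'a::complex_inner set \<Rightarrow> 'b::complex_inner set \<Rightarrow> ('a \<Rightarrow> 'b) set" where
  "bounded_ops S R = {X.
     (\<forall>x\<in>S. X x \<in> R) \<and>
     (\<forall>x\<in>S. \<forall>y\<in>S. X (x + y) = X x + X y) \<and>
     (\<forall>a. \<forall>x\<in>S. X (a *\<^sub>C x) = a *\<^sub>C X x) \<and>
     (\<exists>C. \<forall>x\<in>S. norm (X x) \<le> C * norm x)}"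

definition contractions ::
  "'a::complex_inner set \<Rightarrow> 'b::complex_inner set \<Rightarrow> ('a \<Rightarrow> 'b) set" where
  "contractions S R = {X \<in> bounded_ops S R. \<forall>x\<in>S. norm (X x) \<le> norm x}"

text \<open>The adjoint is unique on \<open>R\<close>.\<close>

definition adjoint_on ::
  "'a::complex_inner set \<Rightarrow> 'b::complex_inner set \<Rightarrow> ('a \<Rightarrow> 'b) \<Rightarrow> 'b \<Rightarrow> 'a" where
  "adjoint_on S R X =
     (SOME Y. Y \<in> bounded_ops R S \<and> (\<forall>x\<in>S. \<forall>y\<in>R. cinner (X x) y = cinner x (Y y)))"

abbreviation cadjoint :: "('a::complex_inner \<Rightarrow> 'b::complex_inner) \<Rightarrow> 'b \<Rightarrow> 'a" where
  "cadjoint \<equiv> adjoint_on UNIV UNIV"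

definition maximal_partial_isometry ::
  "'a::complex_inner set \<Rightarrow> 'b::complex_inner set \<Rightarrow> ('a \<Rightarrow> 'b) \<Rightarrow> bool" where
  "maximal_partial_isometry S R X \<longleftrightarrow>
     X \<in> bounded_ops S R \<and>
     ((\<forall>x\<in>S. adjoint_on S R X (X x) = x) \<or> (\<forall>y\<in>R. X (adjoint_on S R X y) = y))"

definition positive_op :: "('a::complex_inner \<Rightarrow> 'a) \<Rightarrow> bool" where
  "positive_op A \<longleftrightarrow> A \<in> bounded_ops UNIV UNIV \<and> (\<forall>x. cinner (A x) x \<in> \<real>\<^sub>\<ge>\<^sub>0)"

definition op_sqrt :: "('a::complex_inner \<Rightarrow> 'a) \<Rightarrow> 'a \<Rightarrow> 'a" where
  "op_sqrt A = (THE B. positive_op B \<and> (\<forall>x. B (B x) = A x))"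

definition defect :: "('a::complex_inner \<Rightarrow> 'b::complex_inner) \<Rightarrow> 'a \<Rightarrow> 'a" where
  "defect X = op_sqrt (\<lambda>x. x - cadjoint X (X x))"

definition op_kernel :: "('a::complex_inner \<Rightarrow> 'b::complex_inner) \<Rightarrow> 'a set" where
  "op_kernel X = {x. X x = 0}"

text \<open>The subspace \<open>\<HH>\<^sub>1\<close> of \<open>\<HH>\<^sub>1 \<oplus> \<HH>\<^sub>2\<close> consists of the vectors \<open>(f, 0)\<close>.\<close>

definition dual_pair ::
  "('a::complex_inner \<Rightarrow> 'a \<times> 'b::complex_inner) \<Rightarrow> ('a \<Rightarrow> 'a \<times> 'b) \<Rightarrow> bool" where
  "dual_pair T1 T2 \<longleftrightarrow>
     T1 \<in> contractions UNIV UNIV \<and> T2 \<in> contractions UNIV UNIV \<and>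
     (\<forall>f g. cinner (T1 f) (g, 0) = cinner (f, 0) (T2 g)) \<and>
     (\<forall>f g. cinner (T1 f) (g, 0) = cinner (f, 0) (T1 g)) \<and>
     (\<forall>f g. cinner (T2 f) (g, 0) = cinner (f, 0) (T2 g))"

definition C_class :: "real \<Rightarrow> ('a::complex_inner \<Rightarrow> 'a) set" where
  "C_class \<phi> = {T \<in> bounded_ops UNIV UNIV.
     onorm (\<lambda>x. sin \<phi> *\<^sub>R T x + (\<i> * cos \<phi>) *\<^sub>C x) \<le> 1 \<and>
     onorm (\<lambda>x. sin \<phi> *\<^sub>R T x - (\<i> * cos \<phi>) *\<^sub>C x) \<le> 1}"

definition extensions ::
  "('a::complex_inner \<Rightarrow> 'a \<times> 'b::complex_inner) \<Rightarrow> ('a \<Rightarrow> 'a \<times> 'b) \<Rightarrow> ('a \<times> 'b \<Rightarrow> 'a \<times> 'b) set" where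
  "extensions T1 T2 = {T \<in> bounded_ops UNIV UNIV.
     (\<forall>f. T (f, 0) = T1 f) \<and> (\<forall>f. cadjoint T (f, 0) = T2 f)}"

definition Ext ::
  "('a::complex_inner \<Rightarrow> 'a \<times> 'b::complex_inner) \<Rightarrow> ('a \<Rightarrow> 'a \<times> 'b) \<Rightarrow> real
     \<Rightarrow> ('a \<times> 'b \<Rightarrow> 'a \<times> 'b) set" where
  "Ext T1 T2 \<phi> = extensions T1 T2 \<inter> C_class \<phi>"

definition block_op ::
  "('a::complex_inner \<Rightarrow> 'a) \<Rightarrow> ('b::complex_inner \<Rightarrow> 'a) \<Rightarrow> ('a \<Rightarrow> 'b) \<Rightarrow> ('b \<Rightarrow> 'b)
     \<Rightarrow> 'a \<times> 'b \<Rightarrow> 'a \<times> 'b" where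
  "block_op A11 A12 A21 A22 = (\<lambda>(f, g). (A11 f + A12 g, A21 f + A22 g))"

definition defect_space :: "('a::complex_inner \<Rightarrow> 'b::complex_inner) \<Rightarrow> 'a set" where
  "defect_space X = closure (range (defect X))"

text \<open>With \<open>D\<^sub>U\<close> and \<open>D\<^bsub>V*\<^esub>\<close> inverted on \<open>defect_space U\<close> and \<open>defect_space (cadjoint V)\<close>, where they
  are injective, \<open>Q0 V U\<close> is the graph of \<open>D\<^bsub>V*\<^esub>\<^sup>-\<^sup>1 (I - V U) D\<^sub>U\<^sup>-\<^sup>1\<close> on its natural domain.\<close>

definition Q0 ::
  "('a::complex_inner \<Rightarrow> 'b::complex_inner) \<Rightarrow> ('b \<Rightarrow> 'a) \<Rightarrow> ('b \<times> 'b) set" where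
  "Q0 V U = {(defect U h, g) | h g.
     h \<in> defect_space U \<and> g \<in> defect_space (cadjoint V) \<and> defect (cadjoint V) g = h - V (U h)}"

text \<open>Boundedness of \<open>Q\<^sub>0\<close> means the factorization of \<open>I - V U\<close> on the whole space; this is more than
  boundedness of the graph \<open>Q0 V U\<close>, whose domain may fail to be dense in \<open>defect_space U\<close> and
  which does not see \<open>I - V U\<close> on the kernel of \<open>D\<^sub>U\<close>.\<close>

definition Q0_bounded ::
  "('a::complex_inner \<Rightarrow> 'b::complex_inner) \<Rightarrow> ('b \<Rightarrow> 'a) \<Rightarrow> bool" where
  "Q0_bounded V U \<longleftrightarrow>
     (\<exists>Q \<in> bounded_ops (defect_space U) (defect_space (cadjoint V)).
        \<forall>x. x - V (U x) = defect (cadjoint V) (Q (defect U x)))"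

text \<open>The closure of \<open>Q\<^sub>0\<close> as an operator; meaningful only if \<open>Q0_bounded V U\<close>.\<close>

definition Q_cl ::
  "('a::complex_inner \<Rightarrow> 'b::complex_inner) \<Rightarrow> ('b \<Rightarrow> 'a) \<Rightarrow> 'b \<Rightarrow> 'b" where
  "Q_cl V U = (SOME Q. Q \<in> bounded_ops (defect_space U) (defect_space (cadjoint V)) \<and>
     closure (Q0 V U) = {(f, Q f) | f. f \<in> defect_space U})"

definition graph_norm ::
  "('a::real_normed_vector \<times> 'b::real_normed_vector) set \<Rightarrow> real" where
  "graph_norm G = (SUP (f, g)\<in>G. norm g / norm f)"

text \<open>The value \<open>0\<close> for a trivial defect space is a convention; otherwise a bounded \<open>Q\<^sub>0\<close> has norm
  at least \<open>1\<close>.\<close>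

definition phi1 ::
  "('a::complex_inner \<Rightarrow> 'b::complex_inner) \<Rightarrow> ('b \<Rightarrow> 'a) \<Rightarrow> real" where
  "phi1 V U =
     (if \<not> Q0_bounded V U then pi / 2
      else if defect_space U = {0} \<or> defect_space (cadjoint V) = {0} then 0
      else arccos (inverse (graph_norm (Q0 V U))))"

text \<open>For \<open>\<phi> = pi / 2\<close> the factor \<open>cos \<phi>\<close> is \<open>0\<close>, so this is the zero operator even when \<open>Q\<^sub>0\<close> is
  unbounded.\<close>

definition Q_cos ::
  "('a::complex_inner \<Rightarrow> 'b::complex_inner) \<Rightarrow> ('b \<Rightarrow> 'a) \<Rightarrow> real \<Rightarrow> 'b \<Rightarrow> 'b" where
  "Q_cos V U \<phi> = (\<lambda>x. cos \<phi> *\<^sub>R Q_cl V U x)"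

end

theory Submission
  imports Defs
begin

text \<open>Put \<open>A = T\<^sub>1\<^sub>1 sin \<phi> \<plusminus> i cos \<phi>\<close>.  Then \<open>A\<close> is normal and \<open>I - A*A = sin\<^sup>2 \<phi> (I - T\<^sub>1\<^sub>1\<^sup>2)\<close>, so
  \<open>T sin \<phi> \<plusminus> i cos \<phi>\<close> is a block operator with corner \<open>A\<close> and off-diagonal entries \<open>V D\<^sub>A\<close>, \<open>D\<^sub>A U\<close>.
  It is a contraction exactly if its last entry is \<open>- V A* U + D\<^bsub>V*\<^esub> K\<^sub>\<plusminus> D\<^sub>U\<close> for a contraction \<open>K\<^sub>\<plusminus>\<close>.
  Half the sum of the two resulting equations says \<open>T\<^sub>2\<^sub>2 = - V T\<^sub>1\<^sub>1 U + D\<^bsub>V*\<^esub> K D\<^sub>U\<close> with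
  \<open>K sin \<phi> = (K\<^sub>+ + K\<^sub>-) / 2\<close>, and half their difference says \<open>I - V U = D\<^bsub>V*\<^esub> Q D\<^sub>U\<close> with
  \<open>i Q cos \<phi> = (K\<^sub>+ - K\<^sub>-) / 2\<close>.  Hence \<open>\<parallel>Q\<parallel> cos \<phi> \<le> 1\<close>, and conversely \<open>K = 0\<close> is then admissible.
  If \<open>Q cos \<phi>\<close> is a maximal partial isometry, the parallelogram law leaves only \<open>K = 0\<close>.\<close>

section \<open>Complex Hilbert space basics\<close>

text \<open>Normality of \<open>A\<close> gives \<open>A\<close> and \<open>A*\<close> a common
  defect operator, a positive multiple of that of \<open>T\<^sub>1\<^sub>1\<close>, so the same
  \<open>V\<close> and \<open>U\<close> serve both signs. The kernel conditions on \<open>V\<close>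
  and \<open>U\<close> enter in the necessity part: test vectors can be aimed only at the closure of
  the range of that defect operator. Contractivity first bounds an inner product by a sum of two
  squared defect norms; rescaling the two vectors against each other turns the sum into a product,
  from which \<open>K\<^sub>\<plusminus>\<close> is constructed by two Riesz representations. Since
  \<open>Q0\<close> may have a small natural domain, \<open>Q\<close> is built from
  \<open>K\<^sub>+ - K\<^sub>-\<close> and afterwards identified with the closure of
  \<open>Q0\<close>. This divides by \<open>cos \<phi>\<close>; at \<open>\<phi> = pi / 2\<close>
  the difference equation is empty and \<open>Q\<close> need not exist. Turning the norm bound into
  the angle \<open>\<phi>\<^sub>1\<close> rests on \<open>\<parallel>Q\<parallel> \<ge> 1\<close>.
  For a coisometric \<open>Q cos \<phi>\<close> the parallelogram law alone kills \<open>K\<close>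
  only where the norm is attained; an equality case for contractions does the rest.\<close>

lemma inner_scaleC_left: "inner (a *\<^sub>C x) y = inner x (cnj a *\<^sub>C y)"
proof -
  have "cinner x (cnj a *\<^sub>C y) = a * cinner x y"
    by (subst cinner_commute) (simp add: cinner_scaleC_left cinner_commute [of x y])
  then show ?thesis
    by (simp add: Re_cinner [symmetric] cinner_scaleC_left)
qed

lemma scaleC_one [simp]: "1 *\<^sub>C x = x"
  using scaleR_scaleC [of 1 x] by simp

lemma scaleC_minus_one [simp]: "(- 1) *\<^sub>C x = - x"
  using scaleR_scaleC [of "- 1" x] by simp

lemma scaleC_zero_left [simp]: "0 *\<^sub>C x = 0"
  using scaleR_scaleC [of 0 x] by simp

lemma scaleC_minus_left: "(- a) *\<^sub>C x = - (a *\<^sub>C x)"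
  using scaleC_scaleC [of "- 1" a x] by simp

lemma scaleC_minus_right: "a *\<^sub>C (- x) = - (a *\<^sub>C x)"
  using scaleC_scaleC [of a "- 1" x] by (simp add: scaleC_minus_left)

lemma scaleC_diff_right: "a *\<^sub>C (x - y) = a *\<^sub>C x - a *\<^sub>C y"
  using scaleC_add_right [of a x "- y"] by (simp add: scaleC_minus_right)

lemma scaleC_zero_right [simp]: "a *\<^sub>C 0 = 0"
  using scaleC_diff_right [of a 0 0] by simp

lemma scaleC_scaleR_commute: "a *\<^sub>C (r *\<^sub>R x) = r *\<^sub>R (a *\<^sub>C x)"
  by (simp add: scaleR_scaleC scaleC_scaleC mult.commute)

text \<open>The arguments below work with the real inner product; testing against
  \<open>\<i> *\<^sub>C y\<close> as well recovers the imaginary part, so identities for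
  \<open>inner\<close> carry over to \<open>cinner\<close>.\<close>

lemma cinner_eq_Complex: "cinner x y = Complex (inner x y) (inner x (\<i> *\<^sub>C y))"
proof -
  have "cinner x (\<i> *\<^sub>C y) = - \<i> * cinner x y"
    by (subst cinner_commute) (simp add: cinner_scaleC_left cinner_commute [of x y])
  then show ?thesis
    by (simp add: Re_cinner [symmetric])
qed

lemma norm_scaleC: "norm (a *\<^sub>C x) = cmod a * norm x"
proof -
  have "inner (a *\<^sub>C x) (a *\<^sub>C x) = (cmod a)\<^sup>2 * inner x x"
  proof -
    have "inner (a *\<^sub>C x) (a *\<^sub>C x) = inner x ((complex_of_real ((cmod a)\<^sup>2)) *\<^sub>C x)"
      by (simp add: inner_scaleC_left scaleC_scaleC complex_norm_square mult.commute
          del: of_real_power)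
    then show ?thesis
      by (simp add: scaleR_scaleC [symmetric] del: of_real_power)
  qed
  then show ?thesis
    by (simp add: norm_eq_sqrt_inner real_sqrt_mult)
qed

section \<open>Complex subspaces and bounded operators between them\<close>

definition complex_subspace :: "'a::complex_inner set \<Rightarrow> bool" where
  "complex_subspace S \<longleftrightarrow>
     S \<noteq> {} \<and> (\<forall>x\<in>S. \<forall>y\<in>S. x + y \<in> S) \<and> (\<forall>a. \<forall>x\<in>S. a *\<^sub>C x \<in> S)"

lemma complex_subspaceD:
  assumes "complex_subspace S"
  shows "\<And>x y. x \<in> S \<Longrightarrow> y \<in> S \<Longrightarrow> x + y \<in> S"
    and "\<And>a x. x \<in> S \<Longrightarrow> a *\<^sub>C x \<in> S"
    and "0 \<in> S" and "subspace S"
proof -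
  show a: "\<And>x y. x \<in> S \<Longrightarrow> y \<in> S \<Longrightarrow> x + y \<in> S" and c: "\<And>a x. x \<in> S \<Longrightarrow> a *\<^sub>C x \<in> S"
    using assms by (auto simp: complex_subspace_def)
  obtain x where "x \<in> S" using assms by (auto simp: complex_subspace_def)
  then show z: "0 \<in> S" using c [of x 0] by simp
  show "subspace S"
    by (auto simp: subspace_def a z scaleR_scaleC c)
qed

lemma complex_subspace_UNIV [simp]: "complex_subspace UNIV"
  by (auto simp: complex_subspace_def)

lemma bounded_ops_UNIV:
  assumes "X \<in> bounded_ops UNIV UNIV"
  shows "bounded_linear X" and "X (a *\<^sub>C x) = a *\<^sub>C X x"
proof -
  obtain C where C: "\<And>x. norm (X x) \<le> C * norm x"
    using assms by (auto simp: bounded_ops_def)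
  show "bounded_linear X"
    by (rule bounded_linear_intro [where K = C])
      (use assms C in \<open>auto simp: bounded_ops_def scaleR_scaleC mult.commute\<close>)
  show "X (a *\<^sub>C x) = a *\<^sub>C X x"
    using assms by (auto simp: bounded_ops_def)
qed

lemma bounded_ops_UNIV_I:
  assumes "bounded_linear X" and "\<And>a x. X (a *\<^sub>C x) = a *\<^sub>C X x"
  shows "X \<in> bounded_ops UNIV UNIV"
  using assms bounded_linear.bounded [OF assms(1)]
  by (auto simp: bounded_ops_def linear_simps mult.commute)

lemma bounded_ops_cong:
  assumes "complex_subspace S" "\<And>x. x \<in> S \<Longrightarrow> X x = Y x"
  shows "X \<in> bounded_ops S R \<longleftrightarrow> Y \<in> bounded_ops S R"
  using assms complex_subspaceD(1,2) [OF assms(1)] by (simp add: bounded_ops_def)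

text \<open>On the zero subspace the constant in \<open>bounded_ops\<close> may be negative; its
  maximum with zero is safe as a factor.\<close>

lemma bounded_ops_bound:
  assumes "X \<in> bounded_ops S R"
  obtains C where "C \<ge> 0" "\<And>x. x \<in> S \<Longrightarrow> norm (X x) \<le> C * norm x"
proof -
  obtain C where C: "\<forall>x\<in>S. norm (X x) \<le> C * norm x"
    using assms by (auto simp: bounded_ops_def)
  have "norm (X x) \<le> max 0 C * norm x" if "x \<in> S" for x
    using C that mult_right_mono [of C "max 0 C" "norm x"] by fastforce
  then show thesis by (intro that [of "max 0 C"]) auto
qed

lemma bounded_ops_add:
  assumes "complex_subspace S" "complex_subspace R" "X \<in> bounded_ops S R" "Y \<in> bounded_ops S R"
  shows "(\<lambda>x. X x + Y x) \<in> bounded_ops S R"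
proof -
  obtain C where C: "\<And>x. x \<in> S \<Longrightarrow> norm (X x) \<le> C * norm x"
    using bounded_ops_bound assms(3) by blast
  obtain C' where C': "\<And>x. x \<in> S \<Longrightarrow> norm (Y x) \<le> C' * norm x"
    using bounded_ops_bound assms(4) by blast
  have "norm (X x + Y x) \<le> (C + C') * norm x" if "x \<in> S" for x
    using norm_triangle_ineq [of "X x" "Y x"] C [OF that] C' [OF that]
    by (simp add: algebra_simps)
  then have "\<exists>C. \<forall>x\<in>S. norm (X x + Y x) \<le> C * norm x" by blast
  then show ?thesis
    using assms complex_subspaceD(1) [OF assms(2)]
    by (auto simp: bounded_ops_def scaleC_add_right)
qed

lemma bounded_ops_scaleC:
  assumes "complex_subspace R" "X \<in> bounded_ops S R"
  shows "(\<lambda>x. a *\<^sub>C X x) \<in> bounded_ops S R"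
proof -
  obtain C where C: "\<And>x. x \<in> S \<Longrightarrow> norm (X x) \<le> C * norm x"
    using bounded_ops_bound assms(2) by blast
  have "norm (a *\<^sub>C X x) \<le> (cmod a * C) * norm x" if "x \<in> S" for x
    using mult_left_mono [OF C [OF that], of "cmod a"] by (simp add: norm_scaleC mult.assoc)
  then have "\<exists>C. \<forall>x\<in>S. norm (a *\<^sub>C X x) \<le> C * norm x" by blast
  then show ?thesis
    using assms complex_subspaceD(2) [OF assms(1)]
    by (auto simp: bounded_ops_def scaleC_add_right scaleC_scaleC mult.commute)
qed

lemma bounded_ops_scaleR:
  assumes "complex_subspace R" "X \<in> bounded_ops S R"
  shows "(\<lambda>x. r *\<^sub>R X x) \<in> bounded_ops S R"
  using bounded_ops_scaleC [OF assms, of "complex_of_real r"] by (simp add: scaleR_scaleC)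

lemma bounded_ops_diff:
  assumes "complex_subspace S" "complex_subspace R" "X \<in> bounded_ops S R" "Y \<in> bounded_ops S R"
  shows "(\<lambda>x. X x - Y x) \<in> bounded_ops S R"
  using bounded_ops_add [OF assms(1-3) bounded_ops_scaleC [OF assms(2,4), of "- 1"]] by simp

text \<open>The first-order condition at a minimum, for a quadratic vanishing at
  \<open>t = 0\<close>. It serves the Riesz argument, positive forms and the equality case of a
  contraction.\<close>

lemma quadratic_nonneg_imp_linear_0:
  fixes p q :: real
  assumes "\<And>t. 0 \<le> 2 * t * p + t\<^sup>2 * q"
  shows "p = 0"
proof -
  \<comment> \<open>The added one keeps the divisor positive even for \<open>q = 0\<close>;
    \<open>t = - p / c\<close> then minimizes the majorant with \<open>c\<close> in place of
    \<open>q\<close>.\<close>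
  define c where "c = \<bar>q\<bar> + 1"
  have c: "c > 0" "q \<le> c" by (auto simp: c_def)
  have "0 \<le> 2 * (- p / c) * p + (- p / c)\<^sup>2 * q" by (rule assms)
  also have "\<dots> \<le> 2 * (- p / c) * p + (- p / c)\<^sup>2 * c"
    using c by (intro add_left_mono mult_left_mono) auto
  also have "\<dots> = - (p\<^sup>2 / c)"
    using c by (simp add: power2_eq_square field_simps)
  finally have "p\<^sup>2 \<le> 0" using c by (simp add: field_simps)
  then show ?thesis by simp
qed

text \<open>The representing vector minimizes \<open>\<parallel>x\<parallel>\<^sup>2 - 2 f x\<close> over \<open>S\<close>; since \<open>S\<close> need not be closed,
  it is only found in the closure.\<close>

lemma riesz_subspace:
  fixes S :: "'a::{real_inner, complete_space} set" and f :: "'a \<Rightarrow> real"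
  assumes S: "subspace S"
    and add: "\<And>x y. x \<in> S \<Longrightarrow> y \<in> S \<Longrightarrow> f (x + y) = f x + f y"
    and scale: "\<And>r x. x \<in> S \<Longrightarrow> f (r *\<^sub>R x) = r * f x"
    and bound: "\<And>x. x \<in> S \<Longrightarrow> f x \<le> C * norm x"
  obtains z where "z \<in> closure S" "\<And>x. x \<in> S \<Longrightarrow> f x = inner x z" "norm z \<le> max 0 C"
proof -
  define g where "g x = (norm x)\<^sup>2 - 2 * f x" for x
  have lower: "- C\<^sup>2 \<le> g x" if "x \<in> S" for x
    using bound [OF that] zero_le_power2 [of "norm x - C"]
    by (simp add: g_def power2_diff algebra_simps)
  have bdd: "bdd_below (g ` S)"
    using lower by (auto simp: bdd_below_def)
  define m where "m = Inf (g ` S)"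
  have ne: "g ` S \<noteq> {}" using subspace_0 [OF S] by auto
  have m_le: "m \<le> g x" if "x \<in> S" for x
    unfolding m_def using bdd that by (auto intro: cInf_lower)
  have "\<exists>x\<in>S. g x < m + inverse (real (Suc n))" for n
    using cInf_lessD [OF ne, of "m + inverse (real (Suc n))"] by (auto simp: m_def)
  then obtain X where X: "\<And>n. X n \<in> S" "\<And>n. g (X n) < m + inverse (real (Suc n))"
    by metis
  \<comment> \<open>The parallelogram law, in which the linear part of \<open>g\<close> cancels:
    near-minimizers are close because their midpoint, again in \<open>S\<close>, cannot go below the
    infimum.\<close>
  have par: "(norm (x - y))\<^sup>2 = 2 * g x + 2 * g y - 4 * g ((1/2) *\<^sub>R (x + y))"
    if "x \<in> S" "y \<in> S" for x y
    using scale [of "x + y" "1/2"] add [OF that] subspace_add [OF S that]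
    by (simp add: g_def power2_norm_eq_inner inner_simps inner_commute field_simps)
  have dist: "(norm (X i - X j))\<^sup>2 \<le> 2 * inverse (real (Suc i)) + 2 * inverse (real (Suc j))" for i j
  proof -
    have "(1/2) *\<^sub>R (X i + X j) \<in> S"
      using X S by (simp add: subspace_add subspace_scale)
    from m_le [OF this] show ?thesis
      using par [of "X i" "X j"] X [of i] X [of j] by linarith
  qed
  have "Cauchy X"
  proof (rule metric_CauchyI)
    fix e :: real
    assume "0 < e"
    then obtain N where N: "inverse (real (Suc N)) < e\<^sup>2 / 4"
      using reals_Archimedean [of "e\<^sup>2 / 4"] by auto
    have "dist (X i) (X j) < e" if "i \<ge> N" "j \<ge> N" for i j
    proof -
      have "inverse (real (Suc i)) \<le> inverse (real (Suc N))"
        "inverse (real (Suc j)) \<le> inverse (real (Suc N))"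
        using that by (auto intro: le_imp_inverse_le)
      then have "(norm (X i - X j))\<^sup>2 < e\<^sup>2"
        using dist [of i j] N by linarith
      then show ?thesis
        using \<open>0 < e\<close> by (simp add: dist_norm power2_less_imp_less)
    qed
    then show "\<exists>M. \<forall>i\<ge>M. \<forall>j\<ge>M. dist (X i) (X j) < e" by blast
  qed
  then obtain z where z: "X \<longlonglongrightarrow> z"
    using Cauchy_convergent convergent_def by blast
  have zc: "z \<in> closure S"
    using z X(1) closure_sequential by blast
  \<comment> \<open>Minimality is tested along \<open>X n\<close> and passed to the limit, because
    \<open>z\<close> may lie outside \<open>S\<close>, where nothing is assumed about
    \<open>f\<close>.\<close>
  have quad: "0 \<le> 2 * t * (inner z y - f y) + t\<^sup>2 * (norm y)\<^sup>2" if "y \<in> S" for y t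
  proof -
    have "- inverse (real (Suc n)) \<le> 2 * t * (inner (X n) y - f y) + t\<^sup>2 * (norm y)\<^sup>2" for n
    proof -
      have tS: "t *\<^sub>R y \<in> S" using that S by (simp add: subspace_scale)
      have "m \<le> g (X n + t *\<^sub>R y)" using X tS S by (simp add: m_le subspace_add)
      also have "\<dots> = g (X n) + (2 * t * (inner (X n) y - f y) + t\<^sup>2 * (norm y)\<^sup>2)"
      proof -
        have "(norm (X n + t *\<^sub>R y))\<^sup>2
            = (norm (X n))\<^sup>2 + 2 * t * inner (X n) y + t\<^sup>2 * (norm y)\<^sup>2"
          unfolding power2_norm_eq_inner
          by (simp add: inner_simps inner_commute power2_eq_square algebra_simps)
        then show ?thesis
          using add [OF X(1) tS] scale [OF that] by (simp add: g_def algebra_simps)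
      qed
      finally show ?thesis using X(2) [of n] by linarith
    qed
    moreover have "(\<lambda>n. - inverse (real (Suc n))) \<longlonglongrightarrow> 0"
      using tendsto_minus [OF LIMSEQ_inverse_real_of_nat] by simp
    moreover have "(\<lambda>n. 2 * t * (inner (X n) y - f y) + t\<^sup>2 * (norm y)\<^sup>2)
        \<longlonglongrightarrow> 2 * t * (inner z y - f y) + t\<^sup>2 * (norm y)\<^sup>2"
      by (intro tendsto_intros z)
    ultimately show ?thesis
      using LIMSEQ_le by blast
  qed
  have eq: "f y = inner y z" if "y \<in> S" for y
    using quadratic_nonneg_imp_linear_0 [OF quad [OF that]] by (simp add: inner_commute)
  have "inner z z \<le> C * norm z"
  proof (rule LIMSEQ_le)
    show "(\<lambda>n. inner (X n) z) \<longlonglongrightarrow> inner z z" by (intro tendsto_intros z)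
    show "(\<lambda>n. C * norm (X n)) \<longlonglongrightarrow> C * norm z" by (intro tendsto_intros z)
    show "\<exists>N. \<forall>n\<ge>N. inner (X n) z \<le> C * norm (X n)"
      using eq [OF X(1)] bound [OF X(1)] by auto
  qed
  then have "norm z * norm z \<le> C * norm z"
    by (simp add: power2_norm_eq_inner [symmetric] power2_eq_square)
  then have "norm z \<le> max 0 C"
    by (cases "z = 0") auto
  with zc eq show thesis by (rule that)
qed

lemma inner_closure_eq_0:
  fixes S :: "'a::real_inner set"
  assumes "\<And>x. x \<in> S \<Longrightarrow> inner x y = 0" "z \<in> closure S"
  shows "inner z y = 0"
proof -
  obtain X where "\<And>n. X n \<in> S" "X \<longlonglongrightarrow> z"
    using assms(2) closure_sequential by blast
  then have "(\<lambda>n. inner (X n) y) \<longlonglongrightarrow> inner z y"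
    by (intro tendsto_intros)
  moreover have "inner (X n) y = 0" for n
    using assms(1) \<open>\<And>n. X n \<in> S\<close> by blast
  ultimately show ?thesis
    by (simp add: LIMSEQ_const_iff)
qed

text \<open>Applied to differences of both signs, the bound makes \<open>\<phi>\<close> vanish on
  the kernel of \<open>L\<close>. It therefore descends to the range, where an arbitrary preimage
  may be chosen.\<close>

lemma riesz_along:
  fixes L :: "'b::real_vector \<Rightarrow> 'a::{real_inner, complete_space}" and \<phi> :: "'b \<Rightarrow> real"
  assumes L: "linear L" and \<phi>: "linear \<phi>" and bound: "\<And>y. \<phi> y \<le> C * norm (L y)"
  obtains z where "z \<in> closure (range L)" "\<And>y. \<phi> y = inner (L y) z" "norm z \<le> max 0 C"
proof -
  define f where "f s = \<phi> (SOME y. L y = s)" for s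
  have f: "f (L y) = \<phi> y" for y
  proof -
    define y' where "y' = (SOME w. L w = L y)"
    have "L y' = L y" unfolding y'_def by (rule someI) (rule refl)
    then have "L (y' - y) = 0" "L (y - y') = 0"
      by (simp_all add: linear_diff [OF L])
    then have "\<phi> (y' - y) \<le> 0" "\<phi> (y - y') \<le> 0"
      using bound [of "y' - y"] bound [of "y - y'"] by simp_all
    then show ?thesis using \<phi> by (simp add: f_def y'_def [symmetric] linear_diff)
  qed
  have "subspace (range L)" by (simp add: L linear_subspace_image)
  then show thesis
  proof (rule riesz_subspace [where f = f and C = C])
    fix x y assume "x \<in> range L" "y \<in> range L"
    then obtain u v where "x = L u" "y = L v" by auto
    then show "f (x + y) = f x + f y"
      using f [of "u + v"] by (simp add: f linear_add [OF L] linear_add [OF \<phi>])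
  next
    fix r x assume "x \<in> range L"
    then obtain u where "x = L u" by auto
    then show "f (r *\<^sub>R x) = r * f x"
      using f [of "r *\<^sub>R u"] by (simp add: f linear_scale [OF L] linear_scale [OF \<phi>])
  next
    fix x assume "x \<in> range L"
    then show "f x \<le> C * norm x" using bound by (auto simp: f)
  next
    fix z assume "z \<in> closure (range L)" "\<And>x. x \<in> range L \<Longrightarrow> f x = inner x z" "norm z \<le> max 0 C"
    then show thesis using that f by (metis rangeI)
  qed
qed

lemma subspace_closure:
  fixes S :: "'a::real_normed_vector set"
  assumes "subspace S"
  shows "subspace (closure S)"
  unfolding subspace_def
proof (intro conjI ballI allI)
  show "0 \<in> closure S" using assms closure_subset subspace_0 by blast
next
  fix x y assume "x \<in> closure S" "y \<in> closure S"
  then obtain X Y where "\<And>n. X n \<in> S" "X \<longlonglongrightarrow> x" "\<And>n. Y n \<in> S" "Y \<longlonglongrightarrow> y"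
    by (metis closure_sequential)
  then show "x + y \<in> closure S"
    unfolding closure_sequential using assms
    by (intro exI [of _ "\<lambda>n. X n + Y n"]) (auto intro: tendsto_add subspace_add)
next
  fix r :: real and x assume "x \<in> closure S"
  then obtain X where "\<And>n. X n \<in> S" "X \<longlonglongrightarrow> x"
    by (metis closure_sequential)
  then show "r *\<^sub>R x \<in> closure S"
    unfolding closure_sequential using assms
    by (intro exI [of _ "\<lambda>n. r *\<^sub>R X n"]) (auto intro: tendsto_intros subspace_scale)
qed

lemma subspace_closure_range:
  fixes L :: "'b::real_vector \<Rightarrow> 'a::real_normed_vector"
  assumes "linear L"
  shows "subspace (closure (range L))"
  using assms by (intro subspace_closure linear_subspace_image) auto

text \<open>The difference lies in the closure and is orthogonal to it, hence to itself. This
  uniqueness makes vectors chosen by \<open>riesz_along\<close> depend linearly on their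
  data.\<close>

lemma closure_range_eqI:
  fixes L :: "'b::real_vector \<Rightarrow> 'a::real_inner"
  assumes L: "linear L" and "u \<in> closure (range L)" "v \<in> closure (range L)"
    and "\<And>y. inner (L y) u = inner (L y) v"
  shows "u = v"
proof -
  have "u - v \<in> closure (range L)"
    using assms by (intro subspace_diff subspace_closure_range)
  moreover have "inner x (u - v) = 0" if "x \<in> range L" for x
    using that assms(4) by (auto simp: inner_simps)
  ultimately have "inner (u - v) (u - v) = 0"
    by (rule inner_closure_eq_0 [rotated])
  then show ?thesis by simp
qed

text \<open>The closure of the range is the orthogonal complement of the kernel: \<open>p\<close> is
  the projection of \<open>x\<close>, and \<open>x - p\<close> lies in the kernel, so it is
  orthogonal both to \<open>x\<close> and to \<open>p\<close>.\<close>

lemma in_closure_range_selfadjoint: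
  fixes D :: "'a::{real_inner, complete_space} \<Rightarrow> 'a"
  assumes D: "linear D" and sym: "\<And>x y. inner (D x) y = inner x (D y)"
    and x: "\<And>z. D z = 0 \<Longrightarrow> inner x z = 0"
  shows "x \<in> closure (range D)"
proof -
  have lin: "linear (\<lambda>y. inner (D y) x)"
    using D by (intro linearI) (simp_all add: linear_add linear_scale inner_simps)
  obtain p where p: "p \<in> closure (range D)" "\<And>y. inner (D y) x = inner (D y) p"
    using riesz_along [OF D lin, of "norm x"] by (metis norm_cauchy_schwarz mult.commute)
  have "inner y (D (x - p)) = 0" for y
    using p(2) [of y] by (simp add: sym [symmetric] inner_simps)
  then have "D (x - p) = 0" using inner_eq_zero_iff by blast
  then have "inner x (x - p) = 0" by (rule x)
  moreover have "inner p (x - p) = 0"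
    by (rule inner_closure_eq_0 [OF _ p(1)]) (use p(2) in \<open>auto simp: inner_diff_right\<close>)
  ultimately have "inner (x - p) (x - p) = 0"
    by (simp add: inner_simps inner_commute)
  then show ?thesis using p(1) by simp
qed

lemma complex_subspace_closure_range:
  assumes "D \<in> bounded_ops UNIV UNIV"
  shows "complex_subspace (closure (range D))"
  unfolding complex_subspace_def
proof (intro conjI ballI allI)
  have D: "linear D" using bounded_ops_UNIV [OF assms] bounded_linear.linear by auto
  have S: "subspace (closure (range D))"
    using D by (rule subspace_closure_range)
  show "closure (range D) \<noteq> {}" by (simp add: closure_eq_empty)
  show "x + y \<in> closure (range D)" if "x \<in> closure (range D)" "y \<in> closure (range D)" for x y
    using S that by (simp add: subspace_add)
  fix a x assume x: "x \<in> closure (range D)"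
  have "continuous_on UNIV (\<lambda>x. a *\<^sub>C x)"
  proof (rule linear_continuous_on)
    show "bounded_linear (\<lambda>x. a *\<^sub>C x)"
      by (rule bounded_linear_intro [where K = "cmod a"])
        (auto simp: scaleC_add_right scaleC_scaleR_commute norm_scaleC mult.commute)
  qed
  then have "(\<lambda>x. a *\<^sub>C x) ` closure (range D) \<subseteq> closure (range D)"
    using bounded_ops_UNIV(2) [OF assms, of a, symmetric]
    by (intro image_closure_subset) (auto intro: continuous_on_subset closure_subset [THEN subsetD])
  then show "a *\<^sub>C x \<in> closure (range D)" using x by blast
qed

text \<open>Riesz representation is applied, for each \<open>y\<close>, to the real part of the
  pairing. Uniqueness in the closed subspace \<open>S\<close> forces the choice to be complex
  linear, and homogeneity then supplies the imaginary part.\<close>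

lemma adjoint_exists:
  fixes X :: "'a::complex_hilbert \<Rightarrow> 'b::complex_inner"
  assumes S: "complex_subspace S" "closed S" and R: "complex_subspace R"
    and X: "X \<in> bounded_ops S R"
  shows "\<exists>Y. Y \<in> bounded_ops R S \<and> (\<forall>x\<in>S. \<forall>y\<in>R. cinner (X x) y = cinner x (Y y))"
proof -
  note Sr = complex_subspaceD [OF S(1)] and Rr = complex_subspaceD [OF R]
  obtain C where "C \<ge> 0" and C: "\<And>x. x \<in> S \<Longrightarrow> norm (X x) \<le> C * norm x"
    using bounded_ops_bound [OF X] by blast
  have Xr: "X x \<in> R" "X (a *\<^sub>C x) = a *\<^sub>C X x" if "x \<in> S" for x a
    using X that by (auto simp: bounded_ops_def)
  have Xa: "X (x + y) = X x + X y" if "x \<in> S" "y \<in> S" for x y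
    using X that by (auto simp: bounded_ops_def)
  have "\<exists>z. z \<in> S \<and> (\<forall>x\<in>S. inner (X x) y = inner x z) \<and> norm z \<le> max 0 (C * norm y)" for y
  proof (rule riesz_subspace [OF Sr(4)])
    show "inner (X x) y \<le> (C * norm y) * norm x" if "x \<in> S" for x
      using norm_cauchy_schwarz [of "X x" y] mult_right_mono [OF C [OF that], of "norm y"]
      by (simp add: algebra_simps)
    show "inner (X (u + v)) y = inner (X u) y + inner (X v) y" if "u \<in> S" "v \<in> S" for u v
      using that by (simp add: Xa inner_simps)
    show "inner (X (r *\<^sub>R u)) y = r * inner (X u) y" if "u \<in> S" for u r
      using that by (simp add: Xr scaleR_scaleC) (simp add: scaleR_scaleC [symmetric])
    fix z assume "z \<in> closure S" "\<And>x. x \<in> S \<Longrightarrow> inner (X x) y = inner x z"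
      "norm z \<le> max 0 (C * norm y)"
    then show ?thesis using S(2) by auto
  qed
  then obtain Y where Y: "\<And>y. Y y \<in> S" "\<And>x y. x \<in> S \<Longrightarrow> inner (X x) y = inner x (Y y)"
    "\<And>y. norm (Y y) \<le> max 0 (C * norm y)" by metis
  have uniq: "u = v" if "u \<in> S" "v \<in> S" "\<And>x. x \<in> S \<Longrightarrow> inner x u = inner x v" for u v
  proof -
    have "inner (u - v) (u - v) = 0"
      using that subspace_diff [OF Sr(4) that(1,2)] by (simp add: inner_diff_right)
    then show ?thesis by simp
  qed
  have Yadd: "Y (x + y) = Y x + Y y" for x y
    by (rule uniq) (simp_all add: Y(1) Sr inner_add_right Y(2) [symmetric])
  have Ysc: "Y (a *\<^sub>C x) = a *\<^sub>C Y x" for a x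
  proof (rule uniq)
    fix s assume s: "s \<in> S"
    have "inner s (a *\<^sub>C v) = inner (cnj a *\<^sub>C s) v" for v by (simp add: inner_scaleC_left)
    moreover have "inner (X s) (a *\<^sub>C v) = inner (X (cnj a *\<^sub>C s)) v" for v
      using s by (simp add: Xr inner_scaleC_left)
    ultimately show "inner s (Y (a *\<^sub>C x)) = inner s (a *\<^sub>C Y x)"
      using s Sr by (simp add: Y(2) [symmetric])
  qed (simp_all add: Y(1) Sr)
  have "norm (Y y) \<le> C * norm y" for y
    using Y(3) [of y] \<open>C \<ge> 0\<close> by (simp add: max_absorb2)
  then have "Y \<in> bounded_ops R S"
    using Y(1) Yadd Ysc by (auto simp: bounded_ops_def)
  moreover have "cinner (X x) y = cinner x (Y y)" if "x \<in> S" for x y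
    using that by (simp add: cinner_eq_Complex Y(2) Ysc [symmetric])
  ultimately show ?thesis by blast
qed

lemma adjoint_on:
  fixes X :: "'a::complex_hilbert \<Rightarrow> 'b::complex_inner"
  assumes "complex_subspace S" "closed S" "complex_subspace R" "X \<in> bounded_ops S R"
  shows "adjoint_on S R X \<in> bounded_ops R S"
    and "\<And>x y. x \<in> S \<Longrightarrow> y \<in> R \<Longrightarrow> cinner (X x) y = cinner x (adjoint_on S R X y)"
  using someI_ex [OF adjoint_exists [OF assms]] unfolding adjoint_on_def by blast+

lemma cadjoint:
  fixes X :: "'a::complex_hilbert \<Rightarrow> 'b::complex_inner"
  assumes "X \<in> bounded_ops UNIV UNIV"
  shows "cadjoint X \<in> bounded_ops UNIV UNIV"
    and "cinner (X x) y = cinner x (cadjoint X y)"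
    and "inner (X x) y = inner x (cadjoint X y)"
proof -
  show "cadjoint X \<in> bounded_ops UNIV UNIV" using assms by (simp add: adjoint_on)
  show c: "cinner (X x) y = cinner x (cadjoint X y)" using assms by (simp add: adjoint_on)
  from arg_cong [OF this, of Re] show "inner (X x) y = inner x (cadjoint X y)"
    by (simp add: Re_cinner)
qed

lemma cadjoint_eqI:
  fixes X :: "'a::complex_hilbert \<Rightarrow> 'b::complex_inner"
  assumes "X \<in> bounded_ops UNIV UNIV" "\<And>x y. inner (X x) y = inner x (Y y)"
  shows "cadjoint X = Y"
proof
  fix y
  have "inner x (cadjoint X y - Y y) = 0" for x
    using assms(2) [of x y] by (simp add: inner_simps cadjoint(3) [OF assms(1)])
  then show "cadjoint X y = Y y" using inner_eq_zero_iff eq_iff_diff_eq_0 by blast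
qed

lemma cadjoint_contraction:
  fixes X :: "'a::complex_hilbert \<Rightarrow> 'b::complex_hilbert"
  assumes "X \<in> contractions UNIV UNIV"
  shows "cadjoint X \<in> contractions UNIV UNIV"
proof -
  have X: "X \<in> bounded_ops UNIV UNIV" "\<And>x. norm (X x) \<le> norm x"
    using assms by (auto simp: contractions_def)
  have "norm (cadjoint X y) \<le> norm y" for y
  proof -
    have "(norm (cadjoint X y))\<^sup>2 = inner (X (cadjoint X y)) y"
      by (simp add: cadjoint(3) [OF X(1)] power2_norm_eq_inner)
    also have "\<dots> \<le> norm (cadjoint X y) * norm y"
      using norm_cauchy_schwarz X(2) by (meson mult_right_mono norm_ge_zero order_trans)
    finally have "norm (cadjoint X y) * norm (cadjoint X y) \<le> norm (cadjoint X y) * norm y"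
      by (simp add: power2_eq_square)
    then show ?thesis by (cases "cadjoint X y = 0") auto
  qed
  then show ?thesis using cadjoint(1) [OF X(1)] by (simp add: contractions_def)
qed

section \<open>Square roots and defect operators\<close>

text \<open>A fixed point of \<open>Y = (B + Y\<^sup>2) / 2\<close> satisfies
  \<open>(I - Y)\<^sup>2 = I - B\<close>.\<close>

primrec sqrt_iter :: "('a::real_vector \<Rightarrow> 'a) \<Rightarrow> nat \<Rightarrow> 'a \<Rightarrow> 'a" where
  "sqrt_iter B 0 = (\<lambda>x. 0)"
| "sqrt_iter B (Suc n) = (\<lambda>x. (1/2) *\<^sub>R (B x + sqrt_iter B n (sqrt_iter B n x)))"

primrec sqrt_iter_bound :: "nat \<Rightarrow> real" where
  "sqrt_iter_bound 0 = 0"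
| "sqrt_iter_bound (Suc n) = (1 + (sqrt_iter_bound n)\<^sup>2) / 2"

lemma sqrt_iter_bound_range: "0 \<le> sqrt_iter_bound n \<and> sqrt_iter_bound n \<le> 1"
proof (induction n)
  case (Suc n)
  then show ?case using power_le_one [of "sqrt_iter_bound n" 2] by simp
qed simp

lemma incseq_sqrt_iter_bound: "incseq sqrt_iter_bound"
proof (rule incseq_SucI)
  fix n
  have "0 \<le> (1 - sqrt_iter_bound n)\<^sup>2" by simp
  then show "sqrt_iter_bound n \<le> sqrt_iter_bound (Suc n)"
    by (simp add: power2_diff)
qed

lemma linear_sqrt_iter: "linear B \<Longrightarrow> linear (sqrt_iter B n)"
proof (induction n)
  case (Suc n)
  then show ?case
    by (intro linearI) (simp_all add: linear_add linear_scale scaleR_add_right)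
qed (simp add: linear_zero)

text \<open>Every iterate is a polynomial in \<open>B\<close>. The limit inherits the property,
  which later lets \<open>T11\<close> commute with its own defect operator.\<close>

lemma sqrt_iter_commute:
  assumes C: "linear C" and "\<And>x. C (B x) = B (C x)"
  shows "C (sqrt_iter B n x) = sqrt_iter B n (C x)"
  by (induction n arbitrary: x) (simp_all add: assms linear_0 linear_add linear_scale [OF C])

lemma sqrt_iter_selfadjoint:
  fixes B :: "'a::real_inner \<Rightarrow> 'a"
  assumes "\<And>x y. inner (B x) y = inner x (B y)"
  shows "inner (sqrt_iter B n x) y = inner x (sqrt_iter B n y)"
  by (induction n arbitrary: x y) (simp_all add: assms inner_simps)

lemma norm_sqrt_iter:
  fixes B :: "'a::real_normed_vector \<Rightarrow> 'a"
  assumes "\<And>x. norm (B x) \<le> norm x"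
  shows "norm (sqrt_iter B n x) \<le> sqrt_iter_bound n * norm x"
proof (induction n arbitrary: x)
  case (Suc n)
  have "norm (sqrt_iter B n (sqrt_iter B n x)) \<le> sqrt_iter_bound n * (sqrt_iter_bound n * norm x)"
    using Suc [of "sqrt_iter B n x"] Suc [of x] sqrt_iter_bound_range [of n]
    by (meson mult_left_mono order_trans)
  then have "norm (B x + sqrt_iter B n (sqrt_iter B n x))
      \<le> norm x + sqrt_iter_bound n * (sqrt_iter_bound n * norm x)"
    using norm_triangle_ineq assms by (smt (verit))
  then show ?case
    unfolding sqrt_iter.simps norm_scaleR by (simp add: power2_eq_square algebra_simps)
qed simp

lemma norm_sqrt_iter_Suc_diff:
  fixes B :: "'a::real_normed_vector \<Rightarrow> 'a"
  assumes B: "linear B" "\<And>x. norm (B x) \<le> norm x"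
  shows "norm (sqrt_iter B (Suc n) x - sqrt_iter B n x)
    \<le> (sqrt_iter_bound (Suc n) - sqrt_iter_bound n) * norm x"
proof (induction n arbitrary: x)
  case 0
  then show ?case using B(2) [of x] by simp
next
  case (Suc n)
  let ?Y = "sqrt_iter B" and ?a = "sqrt_iter_bound"
  have "?Y (Suc (Suc n)) x - ?Y (Suc n) x
      = (1/2) *\<^sub>R (?Y (Suc n) (?Y (Suc n) x) - ?Y n (?Y n x))"
    unfolding sqrt_iter.simps(2) [of B "Suc n"] by (simp add: scaleR_add_right scaleR_diff_right)
  \<comment> \<open>The identity \<open>a\<^sup>2 - b\<^sup>2 = a (a - b) + (a - b) b\<close> for
    two consecutive iterates, respecting the order of factors; the scalar bounds recombine to a
    difference of squares.\<close>
  also have "\<dots> = (1/2) *\<^sub>R (?Y (Suc n) (?Y (Suc n) x - ?Y n x)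
      + (?Y (Suc n) (?Y n x) - ?Y n (?Y n x)))"
    by (simp only: linear_diff [OF linear_sqrt_iter [OF B(1)]]) simp
  finally have eq: "?Y (Suc (Suc n)) x - ?Y (Suc n) x
      = (1/2) *\<^sub>R (?Y (Suc n) (?Y (Suc n) x - ?Y n x)
        + (?Y (Suc n) (?Y n x) - ?Y n (?Y n x)))" .
  have d: "?a n \<le> ?a (Suc n)" using incseq_SucD [OF incseq_sqrt_iter_bound] .
  have 1: "norm (?Y (Suc n) (?Y (Suc n) x - ?Y n x)) \<le> ?a (Suc n) * ((?a (Suc n) - ?a n) * norm x)"
    using norm_sqrt_iter [OF B(2)] Suc [of x] sqrt_iter_bound_range [of "Suc n"]
    by (meson mult_left_mono order_trans)
  have 2: "norm (?Y (Suc n) (?Y n x) - ?Y n (?Y n x)) \<le> (?a (Suc n) - ?a n) * (?a n * norm x)"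
    using Suc [of "?Y n x"] norm_sqrt_iter [OF B(2), of n x] d
    by (meson diff_ge_0_iff_ge mult_left_mono order_trans)
  have "norm (?Y (Suc (Suc n)) x - ?Y (Suc n) x) \<le> (1/2) *
      (?a (Suc n) * ((?a (Suc n) - ?a n) * norm x) + (?a (Suc n) - ?a n) * (?a n * norm x))"
  proof -
    have "\<bar>1/2 :: real\<bar> = 1/2" by simp
    then show ?thesis
      unfolding eq norm_scaleR
      using mult_left_mono [OF order_trans [OF norm_triangle_ineq add_mono [OF 1 2]], of "1/2"]
      by (simp only:)
  qed
  also have "\<dots> = ((?a (Suc n))\<^sup>2 - (?a n)\<^sup>2) / 2 * norm x"
    by (simp only: power2_eq_square) (simp add: field_simps del: sqrt_iter_bound.simps)
  also have "\<dots> = (?a (Suc (Suc n)) - ?a (Suc n)) * norm x"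
    unfolding sqrt_iter_bound.simps(2) [of "Suc n"] by (simp add: field_simps)
  finally show ?case .
qed

lemma norm_sqrt_iter_diff:
  fixes B :: "'a::real_normed_vector \<Rightarrow> 'a"
  assumes "linear B" "\<And>x. norm (B x) \<le> norm x"
  shows "norm (sqrt_iter B (n + k) x - sqrt_iter B n x)
    \<le> (sqrt_iter_bound (n + k) - sqrt_iter_bound n) * norm x"
proof (induction k)
  case (Suc k)
  have "norm (sqrt_iter B (n + Suc k) x - sqrt_iter B n x)
      \<le> norm (sqrt_iter B (Suc (n + k)) x - sqrt_iter B (n + k) x)
        + norm (sqrt_iter B (n + k) x - sqrt_iter B n x)"
    using norm_triangle_ineq
      [of "sqrt_iter B (Suc (n + k)) x - sqrt_iter B (n + k) x"
        "sqrt_iter B (n + k) x - sqrt_iter B n x"]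
    by (simp del: sqrt_iter.simps)
  also have "\<dots> \<le> (sqrt_iter_bound (Suc (n + k)) - sqrt_iter_bound (n + k)) * norm x
      + (sqrt_iter_bound (n + k) - sqrt_iter_bound n) * norm x"
    by (intro add_mono norm_sqrt_iter_Suc_diff assms Suc)
  finally show ?case by (simp add: algebra_simps del: sqrt_iter_bound.simps sqrt_iter.simps)
qed simp

text \<open>The square root of \<open>I - B\<close> is \<open>I - Y\<close>, where \<open>Y\<close> is the limit of the iteration
  \<open>Y \<mapsto> (B + Y\<^sup>2) / 2\<close>.  The iteration converges in norm because \<open>\<parallel>Y\<^sub>n\<^sub>+\<^sub>1 - Y\<^sub>n\<parallel>\<close> is dominated by
  the same iteration for \<open>B = 1\<close>.\<close>

lemma sqrt_exists:
  fixes B :: "'a::complex_hilbert \<Rightarrow> 'a"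
  assumes B: "B \<in> contractions UNIV UNIV" and sym: "\<And>x y. inner (B x) y = inner x (B y)"
  obtains D where "D \<in> bounded_ops UNIV UNIV" "\<And>x y. inner (D x) y = inner x (D y)"
    "\<And>x. 0 \<le> inner (D x) x" "\<And>x. D (D x) = x - B x"
    "\<And>C x. bounded_linear C \<Longrightarrow> (\<And>x. C (B x) = B (C x)) \<Longrightarrow> C (D x) = D (C x)"
proof -
  have Bb: "B \<in> bounded_ops UNIV UNIV" and Bn: "\<And>x. norm (B x) \<le> norm x"
    using B by (auto simp: contractions_def)
  note Bl = bounded_ops_UNIV [OF Bb]
  have linB: "linear B" by (simp add: Bl bounded_linear.linear)
  let ?Y = "sqrt_iter B"
  have "convergent sqrt_iter_bound"
    using incseq_sqrt_iter_bound sqrt_iter_bound_range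
    by (intro Bseq_monoseq_convergent BseqI' [of _ 1] incseq_imp_monoseq) auto
  then have aC: "Cauchy sqrt_iter_bound" by (rule convergent_Cauchy)
  have "Cauchy (\<lambda>n. ?Y n x)" for x
  proof (rule metric_CauchyI)
    fix e :: real assume "0 < e"
    define e' where "e' = e / (norm x + 1)"
    have "0 < norm x + 1" using norm_ge_zero [of x] by linarith
    then have "0 < e'" using \<open>0 < e\<close> by (simp add: e'_def)
    then obtain N where N: "\<And>m n. m \<ge> N \<Longrightarrow> n \<ge> N \<Longrightarrow> dist (sqrt_iter_bound m) (sqrt_iter_bound n) < e'"
      using aC unfolding Cauchy_def by metis
    have *: "dist (?Y (n + k) x) (?Y n x) < e" if "n \<ge> N" for n k
    proof -
      have "dist (?Y (n + k) x) (?Y n x) \<le> (sqrt_iter_bound (n + k) - sqrt_iter_bound n) * norm x"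
        by (simp add: dist_norm norm_sqrt_iter_diff linB Bn)
      also have "\<dots> \<le> e' * norm x"
        using N [of "n + k" n] that by (intro mult_right_mono) (auto simp: dist_real_def)
      also have "\<dots> < e"
        using \<open>0 < e\<close> \<open>0 < norm x + 1\<close> by (simp add: e'_def field_simps)
      finally show ?thesis .
    qed
    have "dist (?Y m x) (?Y n x) < e" if "m \<ge> N" "n \<ge> N" for m n
      using *[of n "m - n"] *[of m "n - m"] that
      by (cases "n \<le> m") (auto simp: dist_commute)
    then show "\<exists>M. \<forall>m\<ge>M. \<forall>n\<ge>M. dist (?Y m x) (?Y n x) < e" by blast
  qed
  then have "\<exists>y. (\<lambda>n. ?Y n x) \<longlonglongrightarrow> y" for x
    using Cauchy_convergent convergent_def by blast
  then obtain Y where Y: "\<And>x. (\<lambda>n. ?Y n x) \<longlonglongrightarrow> Y x" by metis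
  have Ycomm: "C (Y x) = Y (C x)" if "bounded_linear C" "\<And>x. C (B x) = B (C x)" for C x
  proof -
    have "(\<lambda>n. C (?Y n x)) \<longlonglongrightarrow> C (Y x)"
      by (rule bounded_linear.tendsto [OF that(1) Y])
    moreover have "(\<lambda>n. C (?Y n x)) = (\<lambda>n. ?Y n (C x))"
      using that by (auto simp: sqrt_iter_commute bounded_linear.linear)
    ultimately show ?thesis using Y LIMSEQ_unique by metis
  qed
  have Yadd: "Y (x + y) = Y x + Y y" for x y
  proof -
    have "(\<lambda>n. ?Y n (x + y)) \<longlonglongrightarrow> Y x + Y y"
      using tendsto_add [OF Y [of x] Y [of y]] by (simp add: linear_add [OF linear_sqrt_iter [OF linB]])
    then show ?thesis using Y LIMSEQ_unique by metis
  qed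
  \<comment> \<open>Multiplication by a complex scalar commutes with \<open>B\<close>, so
    homogeneity is an instance of the commutation property.\<close>
  have Ysc: "Y (a *\<^sub>C x) = a *\<^sub>C Y x" for a x
  proof -
    have "bounded_linear (\<lambda>x. a *\<^sub>C x)"
      by (rule bounded_linear_intro [where K = "cmod a"])
        (auto simp: scaleC_add_right scaleC_scaleR_commute norm_scaleC mult.commute)
    then show ?thesis using Ycomm [of "\<lambda>x. a *\<^sub>C x" x] Bl(2) [of a] by metis
  qed
  have Ysym: "inner (Y x) y = inner x (Y y)" for x y
  proof -
    have "(\<lambda>n. inner (?Y n x) y) \<longlonglongrightarrow> inner (Y x) y" "(\<lambda>n. inner x (?Y n y)) \<longlonglongrightarrow> inner x (Y y)"
      by (intro tendsto_intros Y)+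
    then show ?thesis
      by (simp add: sqrt_iter_selfadjoint [OF sym] LIMSEQ_unique)
  qed
  have nY: "norm (?Y n x) \<le> norm x" for n x
    using norm_sqrt_iter [OF Bn, of n x] sqrt_iter_bound_range [of n]
      mult_right_mono [of "sqrt_iter_bound n" 1 "norm x"] by simp
  have Yn: "norm (Y x) \<le> norm x" for x
    using tendsto_norm [OF Y [of x]] nY by (intro LIMSEQ_le_const2) auto
  have YY: "2 *\<^sub>R Y x = B x + Y (Y x)" for x
  proof -
    \<comment> \<open>Operator and argument vary together; since all iterates are contractions, the
      error in the argument alone tends to zero.\<close>
    have "(\<lambda>n. ?Y n (?Y n x - Y x)) \<longlonglongrightarrow> 0"
    proof (rule Lim_null_comparison)
      show "\<forall>\<^sub>F n in sequentially. norm (?Y n (?Y n x - Y x)) \<le> norm (?Y n x - Y x)"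
        by (simp add: nY)
      show "(\<lambda>n. norm (?Y n x - Y x)) \<longlonglongrightarrow> 0"
        using Y [of x] by (simp add: LIM_zero tendsto_norm_zero)
    qed
    from tendsto_add [OF this Y [of "Y x"]] have "(\<lambda>n. ?Y n (?Y n x)) \<longlonglongrightarrow> Y (Y x)"
      by (simp add: linear_diff [OF linear_sqrt_iter [OF linB]])
    then have "(\<lambda>n. ?Y (Suc n) x) \<longlonglongrightarrow> (1/2) *\<^sub>R (B x + Y (Y x))"
      unfolding sqrt_iter.simps by (intro tendsto_intros)
    moreover have "(\<lambda>n. ?Y (Suc n) x) \<longlonglongrightarrow> Y x"
      using Y by (rule LIMSEQ_Suc)
    ultimately have "Y x = (1/2) *\<^sub>R (B x + Y (Y x))" using LIMSEQ_unique by blast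
    then show ?thesis by (metis (no_types, lifting) scaleR_half_double scaleR_2 scaleR_add_right)
  qed
  define D where "D x = x - Y x" for x
  have Yb: "Y \<in> bounded_ops UNIV UNIV"
    using Yadd Ysc Yn by (auto simp: bounded_ops_def intro: exI [of _ 1])
  have Yl: "Y (x - y) = Y x - Y y" for x y
    using bounded_ops_UNIV [OF Yb] by (simp add: linear_diff bounded_linear.linear)
  show thesis
  proof (rule that [of D])
    have "(\<lambda>x. x) \<in> bounded_ops UNIV UNIV" by (auto simp: bounded_ops_def intro: exI [of _ 1])
    then show "D \<in> bounded_ops UNIV UNIV"
      unfolding D_def using Yb by (intro bounded_ops_diff) auto
    show "inner (D x) y = inner x (D y)" for x y by (simp add: D_def inner_simps Ysym)
    show "0 \<le> inner (D x) x" for x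
    proof -
      have "inner (Y x) x \<le> norm x * norm x"
        using norm_cauchy_schwarz Yn by (meson mult_right_mono norm_ge_zero order_trans)
      then show ?thesis
        by (simp add: D_def inner_simps power2_norm_eq_inner [symmetric] power2_eq_square)
    qed
    show "D (D x) = x - B x" for x
      using YY [of x] by (simp add: D_def Yl scaleR_2 algebra_simps)
    show "C (D x) = D (C x)" if "bounded_linear C" "\<And>x. C (B x) = B (C x)" for C x
      using Ycomm [OF that] that(1) by (simp add: D_def linear_diff bounded_linear.linear)
  qed
qed

text \<open>Real symmetry and complex linearity, applied to \<open>x\<close> and
  \<open>\<i> *\<^sub>C x\<close>, make the imaginary part its own negative.\<close>

lemma cinner_nonneg_RealsI:
  fixes A :: "'a::complex_inner \<Rightarrow> 'a"
  assumes A: "A \<in> bounded_ops UNIV UNIV" and sym: "\<And>x y. inner (A x) y = inner x (A y)"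
    and pos: "\<And>x. 0 \<le> inner (A x) x"
  shows "cinner (A x) x \<in> \<real>\<^sub>\<ge>\<^sub>0"
proof -
  have "inner (A x) (\<i> *\<^sub>C x) = inner x (\<i> *\<^sub>C A x)"
    by (simp add: sym bounded_ops_UNIV(2) [OF A])
  also have "\<dots> = - inner (\<i> *\<^sub>C x) (A x)"
    by (simp add: inner_scaleC_left scaleC_minus_left)
  finally have "inner (A x) (\<i> *\<^sub>C x) = 0" by (simp add: inner_commute)
  then show ?thesis
    using pos by (simp add: cinner_eq_Complex complex_nonneg_Reals_iff)
qed

text \<open>Polarization: over the complex numbers a real quadratic form forces self-adjointness.\<close>

lemma positive_op_inner:
  assumes "positive_op A"
  shows "inner (A x) y = inner x (A y)" and "0 \<le> inner (A x) x"
proof -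
  have A: "A \<in> bounded_ops UNIV UNIV" and p: "\<And>x. cinner (A x) x \<in> \<real>\<^sub>\<ge>\<^sub>0"
    using assms by (auto simp: positive_op_def)
  note Al = bounded_ops_UNIV [OF A]
  have lin: "A (x + y) = A x + A y" for x y
    using Al by (simp add: linear_add bounded_linear.linear)
  show "0 \<le> inner (A x) x"
    using p [of x] by (simp add: cinner_eq_Complex complex_nonneg_Reals_iff)
  have im: "inner (A x) (\<i> *\<^sub>C x) = 0" for x
    using p [of x] by (simp add: cinner_eq_Complex complex_nonneg_Reals_iff)
  have "inner (A x) (\<i> *\<^sub>C y) = - inner (A y) (\<i> *\<^sub>C x)" for x y
    using im [of "x + y"] im [of x] im [of y] by (simp add: lin inner_simps scaleC_add_right)
  from this [of x "- (\<i> *\<^sub>C y)"]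
  have "inner (A x) y = - inner (A (- (\<i> *\<^sub>C y))) (\<i> *\<^sub>C x)"
    by (simp add: scaleC_minus_right scaleC_scaleC)
  also have "\<dots> = inner (\<i> *\<^sub>C A y) (\<i> *\<^sub>C x)"
    using Al(2) [of "- \<i>" y] by (simp add: scaleC_minus_left)
  also have "\<dots> = inner (A y) x"
    by (simp add: inner_scaleC_left scaleC_scaleC)
  finally show "inner (A x) y = inner x (A y)" by (simp add: inner_commute)
qed

text \<open>The quadratic form attains its minimum zero at \<open>x\<close>, and its first variation
  in the direction \<open>A x\<close> is \<open>2 * inner (A x) (A x)\<close>.\<close>

lemma positive_op_inner_eq_0:
  assumes "positive_op A" "inner (A x) x = 0"
  shows "A x = 0"
proof -
  note sym = positive_op_inner [OF assms(1)]
  have lin: "linear A"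
    using assms(1) by (auto simp: positive_op_def bounded_ops_UNIV bounded_linear.linear)
  have "0 \<le> 2 * t * inner (A x) (A x) + t\<^sup>2 * inner (A (A x)) (A x)" for t
  proof -
    have "0 \<le> inner (A (x + t *\<^sub>R A x)) (x + t *\<^sub>R A x)" by (rule sym)
    also have "\<dots> = 2 * t * inner (A x) (A x) + t\<^sup>2 * inner (A (A x)) (A x)"
      using assms(2) sym(1) [of "A x" x]
      by (simp add: linear_add [OF lin] linear_scale [OF lin] inner_simps power2_eq_square
          algebra_simps)
    finally show ?thesis .
  qed
  then have "inner (A x) (A x) = 0" by (rule quadratic_nonneg_imp_linear_0)
  then show ?thesis by simp
qed

text \<open>Uniqueness gives \<open>THE\<close> its meaning. A positive root \<open>F\<close>
  commutes with \<open>B\<close>, hence with the constructed root \<open>E\<close>, so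
  \<open>(F + E) (F - E) = 0\<close>; positivity makes \<open>F\<close> and \<open>E\<close> both
  vanish on \<open>y = (F - E) x\<close>, and symmetry gives \<open>inner y y = 0\<close>.\<close>

lemma op_sqrt:
  fixes B :: "'a::complex_hilbert \<Rightarrow> 'a"
  assumes B: "B \<in> contractions UNIV UNIV" and sym: "\<And>x y. inner (B x) y = inner x (B y)"
  defines "D \<equiv> op_sqrt (\<lambda>x. x - B x)"
  shows "positive_op D" and "D (D x) = x - B x"
    and "bounded_linear C \<Longrightarrow> (\<And>x. C (B x) = B (C x)) \<Longrightarrow> C (D x) = D (C x)"
proof -
  obtain E where E: "E \<in> bounded_ops UNIV UNIV" "\<And>x y. inner (E x) y = inner x (E y)"
    "\<And>x. 0 \<le> inner (E x) x" "\<And>x. E (E x) = x - B x"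
    and comm: "\<And>C x. bounded_linear C \<Longrightarrow> (\<And>x. C (B x) = B (C x)) \<Longrightarrow> C (E x) = E (C x)"
    by (rule sqrt_exists [OF B sym]) blast
  have pE: "positive_op E"
    unfolding positive_op_def using E by (auto intro: cinner_nonneg_RealsI)
  have uniq: "F = E" if F: "positive_op F" and FF: "\<And>x. F (F x) = x - B x" for F
  proof
    fix x
    have Fb: "bounded_linear F" and Eb: "bounded_linear E"
      using F E(1) by (auto simp: positive_op_def bounded_ops_UNIV)
    note lin = linear_diff [OF bounded_linear.linear]
    have "F (B x) = B (F x)" for x
    proof -
      have "F (x - B x) = F x - B (F x)" using FF [of x] FF [of "F x"] by simp
      then show ?thesis using lin [OF Fb] by simp
    qed
    then have FE: "F (E x) = E (F x)" for x using comm [OF Fb] by blast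
    define y where "y = F x - E x"
    have "F y + E y = 0"
      by (simp add: y_def lin [OF Fb] lin [OF Eb] FF E FE)
    then have "inner (F y) y + inner (E y) y = 0"
      by (simp add: inner_add_left [symmetric])
    then have "inner (F y) y = 0" "inner (E y) y = 0"
      using positive_op_inner(2) [OF F, of y] E(3) [of y] by linarith+
    then have 0: "F y = 0" "E y = 0"
      using F pE by (auto intro: positive_op_inner_eq_0)
    have "inner y y = inner (F y) x - inner (E y) x"
      by (subst (2) y_def) (simp add: inner_diff_right positive_op_inner(1) [OF F] E(2))
    then have "y = 0" by (simp only: 0) simp
    then show "F x = E x" by (simp add: y_def)
  qed
  have eq: "D = E"
    unfolding D_def op_sqrt_def
  proof (rule the_equality)
    show "positive_op E \<and> (\<forall>x. E (E x) = x - B x)" using pE E(4) by blast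
    show "F = E" if "positive_op F \<and> (\<forall>x. F (F x) = x - B x)" for F
      using uniq [of F] that by blast
  qed
  show "positive_op D" and "D (D x) = x - B x"
    and "bounded_linear C \<Longrightarrow> (\<And>x. C (B x) = B (C x)) \<Longrightarrow> C (D x) = D (C x)"
    unfolding eq using pE E(4) comm by blast+
qed

lemma defect:
  fixes X :: "'a::complex_hilbert \<Rightarrow> 'b::complex_hilbert"
  assumes X: "X \<in> contractions UNIV UNIV"
  shows "defect X \<in> bounded_ops UNIV UNIV"
    and "inner (defect X x) y = inner x (defect X y)"
    and "defect X (defect X x) = x - cadjoint X (X x)"
    and "(norm (defect X x))\<^sup>2 = (norm x)\<^sup>2 - (norm (X x))\<^sup>2"
    and "bounded_linear C \<Longrightarrow> (\<And>x. C (cadjoint X (X x)) = cadjoint X (X (C x)))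
      \<Longrightarrow> C (defect X x) = defect X (C x)"
proof -
  have Xb: "X \<in> bounded_ops UNIV UNIV" and Xn: "\<And>x. norm (X x) \<le> norm x"
    using X by (auto simp: contractions_def)
  note adj = cadjoint [OF Xb]
  have Yn: "norm (cadjoint X x) \<le> norm x" for x
    using cadjoint_contraction [OF X] by (auto simp: contractions_def)
  let ?B = "\<lambda>x. cadjoint X (X x)"
  have B: "?B \<in> contractions UNIV UNIV"
    unfolding contractions_def
  proof (intro CollectI conjI ballI)
    show n: "norm (?B x) \<le> norm x" for x using Xn Yn order_trans by blast
    show "?B \<in> bounded_ops UNIV UNIV"
      by (intro bounded_ops_UNIV_I bounded_linear_compose [OF bounded_ops_UNIV(1) [OF adj(1)]
          bounded_ops_UNIV(1) [OF Xb]])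
        (simp add: bounded_ops_UNIV(2) [OF Xb] bounded_ops_UNIV(2) [OF adj(1)])
  qed
  have sym: "inner (?B x) y = inner x (?B y)" for x y
    by (metis adj(3) inner_commute)
  note S = op_sqrt [OF B sym, folded defect_def]
  show "defect X \<in> bounded_ops UNIV UNIV" using S(1) by (simp add: positive_op_def)
  show sy: "inner (defect X x) y = inner x (defect X y)" for x y
    using positive_op_inner(1) [OF S(1)] .
  show sq: "defect X (defect X x) = x - cadjoint X (X x)" for x using S(2) .
  show "(norm (defect X x))\<^sup>2 = (norm x)\<^sup>2 - (norm (X x))\<^sup>2"
    by (simp add: power2_norm_eq_inner sy sq inner_diff_right adj(3))
  show "bounded_linear C \<Longrightarrow> (\<And>x. C (cadjoint X (X x)) = cadjoint X (X (C x)))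
      \<Longrightarrow> C (defect X x) = defect X (C x)"
    using S(3) .
qed

section \<open>Douglas factorization and contractive blocks\<close>

text \<open>The choice \<open>t\<^sup>2 = b / a\<close> makes both squares equal to
  \<open>a * b\<close>; shifting \<open>a\<close> and \<open>b\<close> by a small \<open>e\<close>
  covers zero values.\<close>

lemma le_mult_of_le_scaled_squares:
  fixes a b r :: real
  assumes "0 \<le> a" "0 \<le> b" and le: "\<And>t. t > 0 \<Longrightarrow> 2 * r \<le> (t * a)\<^sup>2 + (b / t)\<^sup>2"
  shows "r \<le> a * b"
proof -
  have *: "r \<le> (a + e) * (b + e)" if "e > 0" for e
  proof -
    define t where "t = sqrt ((b + e) / (a + e))"
    have pos: "a + e > 0" "b + e > 0" using that assms by auto
    have t: "t > 0" "t\<^sup>2 = (b + e) / (a + e)"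
      using pos by (auto simp: t_def)
    have "2 * r \<le> (t * a)\<^sup>2 + (b / t)\<^sup>2" using le t by blast
    also have "\<dots> \<le> (t * (a + e))\<^sup>2 + ((b + e) / t)\<^sup>2"
      using assms that t(1) by (intro add_mono power_mono mult_left_mono divide_right_mono) auto
    also have "\<dots> = 2 * ((a + e) * (b + e))"
      using pos by (simp add: power_mult_distrib power_divide t(2)) (simp add: power2_eq_square)
    finally show ?thesis by simp
  qed
  have "(\<lambda>n. (a + inverse (real (Suc n))) * (b + inverse (real (Suc n)))) \<longlonglongrightarrow> (a + 0) * (b + 0)"
    by (intro tendsto_intros LIMSEQ_inverse_real_of_nat)
  then have "r \<le> (a + 0) * (b + 0)"
    using * by (intro LIMSEQ_le_const) (auto simp del: of_nat_Suc)
  then show ?thesis by simp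
qed

lemma inner_le_half_squares: "2 * inner x y \<le> (norm x)\<^sup>2 + (norm y)\<^sup>2"
  using zero_le_power2 [of "norm (x - y)"]
  by (simp add: power2_norm_eq_inner inner_simps inner_commute)

text \<open>Two rounds of Riesz representation: \<open>w y\<close> represents the pairing of
  \<open>Y g\<close> with \<open>y\<close> along \<open>D\<close>, and \<open>K x\<close> represents
  the pairing of \<open>w y\<close> with \<open>x\<close> along \<open>D'\<close>. Thus
  \<open>w\<close> acts as \<open>K* D'\<close>, and the product bound gives
  \<open>norm (w y) \<le> norm (D' y)\<close>, which makes \<open>K\<close> a contraction.\<close>

lemma douglas_factorization:
  fixes D :: "'a::complex_hilbert \<Rightarrow> 'a" and D' :: "'b::complex_hilbert \<Rightarrow> 'b" and Y :: "'a \<Rightarrow> 'b"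
  assumes D: "D \<in> bounded_ops UNIV UNIV"
    and D': "D' \<in> bounded_ops UNIV UNIV" "\<And>x y. inner (D' x) y = inner x (D' y)"
    and Y: "Y \<in> bounded_ops UNIV UNIV"
    and bound: "\<And>g y. inner (Y g) y \<le> norm (D g) * norm (D' y)"
  obtains K where "K \<in> contractions (closure (range D)) (closure (range D'))"
    "\<And>g. Y g = D' (K (D g))"
proof -
  note Dl = bounded_ops_UNIV [OF D] and D'l = bounded_ops_UNIV [OF D'(1)]
    and Yl = bounded_ops_UNIV [OF Y]
  note linD = bounded_linear.linear [OF Dl(1)] and linD' = bounded_linear.linear [OF D'l(1)]
    and linY = bounded_linear.linear [OF Yl(1)]
  note cD = complex_subspaceD [OF complex_subspace_closure_range [OF D]]
    and cD' = complex_subspaceD [OF complex_subspace_closure_range [OF D'(1)]]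
  have "\<exists>w. w \<in> closure (range D) \<and> (\<forall>g. inner (Y g) y = inner (D g) w) \<and> norm w \<le> norm (D' y)"
    for y
  proof -
    have lin: "linear (\<lambda>g. inner (Y g) y)"
      by (intro linearI) (simp_all add: linear_add [OF linY] linear_scale [OF linY] inner_simps)
    have "inner (Y g) y \<le> norm (D' y) * norm (D g)" for g
      using bound [of g y] by (simp add: mult.commute)
    then show ?thesis
      by (rule riesz_along [OF linD lin]) (simp add: max_absorb2, blast)
  qed
  then obtain w where w: "\<And>y. w y \<in> closure (range D)"
    "\<And>g y. inner (Y g) y = inner (D g) (w y)" "\<And>y. norm (w y) \<le> norm (D' y)" by metis
  have wadd: "w (x + y) = w x + w y" for x y
    by (rule closure_range_eqI [OF linD])
      (simp_all add: w(1) cD(1) inner_add_right w(2) [symmetric])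
  have wsc: "w (a *\<^sub>C x) = a *\<^sub>C w x" for a x
  proof (rule closure_range_eqI [OF linD])
    fix y
    have "inner (D y) (w (a *\<^sub>C x)) = inner (Y (cnj a *\<^sub>C y)) x"
      by (simp add: w(2) [symmetric] Yl(2) inner_scaleC_left)
    also have "\<dots> = inner (D y) (a *\<^sub>C w x)"
      by (simp add: w(2) Dl(2) inner_scaleC_left)
    finally show "inner (D y) (w (a *\<^sub>C x)) = inner (D y) (a *\<^sub>C w x)" .
  qed (simp_all add: w(1) cD(2))
  have "\<exists>k. k \<in> closure (range D') \<and> (\<forall>y. inner (w y) x = inner (D' y) k) \<and> norm k \<le> norm x"
    for x
  proof -
    have lin: "linear (\<lambda>y. inner (w y) x)"
      by (intro linearI) (simp_all add: wadd scaleR_scaleC wsc inner_simps,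
        simp add: scaleR_scaleC [symmetric])
    have "inner (w y) x \<le> norm x * norm (D' y)" for y
      using norm_cauchy_schwarz [of "w y" x] mult_right_mono [OF w(3) [of y], of "norm x"]
      by (simp add: mult.commute)
    then show ?thesis
      by (rule riesz_along [OF linD' lin]) (simp add: max_absorb2, blast)
  qed
  then obtain K where K: "\<And>x. K x \<in> closure (range D')"
    "\<And>x y. inner (w y) x = inner (D' y) (K x)" "\<And>x. norm (K x) \<le> norm x" by metis
  have Kadd: "K (x + y) = K x + K y" for x y
    by (rule closure_range_eqI [OF linD'])
      (simp_all add: K(1) cD'(1) inner_add_right K(2) [symmetric])
  have Ksc: "K (a *\<^sub>C x) = a *\<^sub>C K x" for a x
  proof (rule closure_range_eqI [OF linD'])
    fix y
    have "inner (D' y) (K (a *\<^sub>C x)) = inner (w (cnj a *\<^sub>C y)) x"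
      by (simp add: K(2) [symmetric] wsc inner_scaleC_left)
    also have "\<dots> = inner (D' y) (a *\<^sub>C K x)"
      by (simp add: K(2) D'l(2) inner_scaleC_left)
    finally show "inner (D' y) (K (a *\<^sub>C x)) = inner (D' y) (a *\<^sub>C K x)" .
  qed (simp_all add: K(1) cD'(2))
  show thesis
  proof (rule that)
    show "K \<in> contractions (closure (range D)) (closure (range D'))"
      using K(1,3) Kadd Ksc by (auto simp: contractions_def bounded_ops_def intro: exI [of _ 1])
    fix g
    have "inner y (Y g - D' (K (D g))) = 0" for y
    proof -
      have "inner y (Y g) = inner (w y) (D g)" by (metis inner_commute w(2))
      also have "\<dots> = inner y (D' (K (D g)))" by (simp add: K(2) D'(2))
      finally show ?thesis by (simp add: inner_diff_right)
    qed
    then show "Y g = D' (K (D g))" using inner_eq_zero_iff eq_iff_diff_eq_0 by blast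
  qed
qed

text \<open>The matrix with rows \<open>(A, E)\<close> and \<open>(E, -A*)\<close> is unitary.  A block operator with first column
  \<open>(A, V E)\<close> and first row \<open>(A, E U)\<close> is compared with the compression of this unitary by
  \<open>diag (I, V)\<close> and \<open>diag (I, U)\<close>.\<close>

lemma julia_isometric:
  fixes A A' E :: "'a::real_inner \<Rightarrow> 'a"
  assumes A': "\<And>x y. inner (A x) y = inner x (A' y)"
    and E: "\<And>x y. inner (E x) y = inner x (E y)" and AE: "\<And>x. A (E x) = E (A x)"
    and AA: "\<And>x. A' (A x) = x - E (E x)" "\<And>x. A (A' x) = x - E (E x)"
  shows "(norm (A f + E u))\<^sup>2 + (norm (E f - A' u))\<^sup>2 = (norm f)\<^sup>2 + (norm u)\<^sup>2"
proof -
  have A'2: "inner (A' x) y = inner x (A y)" for x y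
    using A' [of y x] by (simp add: inner_commute)
  have 1: "inner (A f) (A f) = inner f f - inner f (E (E f))"
    by (simp add: A' AA inner_diff_right)
  have 2: "inner (A' u) (A' u) = inner u u - inner u (E (E u))"
    by (simp add: A'2 AA inner_diff_right)
  have 3: "inner (E f) (E f) = inner f (E (E f))" "inner (E u) (E u) = inner u (E (E u))"
    by (simp_all add: E)
  have 4: "inner (A f) (E u) = inner (E f) (A' u)"
  proof -
    have "inner (A f) (E u) = inner (E (A f)) u" by (simp add: E)
    also have "\<dots> = inner (E f) (A' u)" by (simp add: AE [symmetric] A')
    finally show ?thesis .
  qed
  show ?thesis
    unfolding power2_norm_eq_inner inner_add_left inner_add_right inner_diff_left inner_diff_right
    using 1 2 3 4 inner_commute [of "A f" "E u"] inner_commute [of "E f" "A' u"] by linarith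
qed

text \<open>The map from \<open>(u, k)\<close> to \<open>V u + DV k\<close> is contractive because
  its adjoint, sending \<open>z\<close> to \<open>(V' z, DV z)\<close>, is isometric; pairing the
  image with itself expresses this directly.\<close>

lemma block_contraction:
  fixes A A' E :: "'a::real_inner \<Rightarrow> 'a" and V :: "'a \<Rightarrow> 'b::real_inner"
  assumes julia: "\<And>f u. (norm (A f + E u))\<^sup>2 + (norm (E f - A' u))\<^sup>2 = (norm f)\<^sup>2 + (norm u)\<^sup>2"
    and V: "\<And>x y. inner (V x) y = inner x (V' y)"
    and DV: "\<And>x y. inner (DV x) y = inner x (DV y)"
      "\<And>y. (norm (DV y))\<^sup>2 = (norm y)\<^sup>2 - (norm (V' y))\<^sup>2"
    and k: "(norm k)\<^sup>2 \<le> (norm g)\<^sup>2 - (norm (U g))\<^sup>2"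
  shows "(norm (A f + E (U g)))\<^sup>2 + (norm (V (E f - A' (U g)) + DV k))\<^sup>2 \<le> (norm f)\<^sup>2 + (norm g)\<^sup>2"
proof -
  define u where "u = E f - A' (U g)"
  define z where "z = V u + DV k"
  have "(norm z)\<^sup>2 = inner (V u) z + inner (DV k) z"
    unfolding power2_norm_eq_inner by (subst (1) z_def) (rule inner_add_left)
  also have "\<dots> = inner u (V' z) + inner k (DV z)" by (simp add: V DV(1))
  finally have "2 * (norm z)\<^sup>2 \<le> (norm u)\<^sup>2 + (norm (V' z))\<^sup>2 + (norm k)\<^sup>2 + (norm (DV z))\<^sup>2"
    using inner_le_half_squares [of u "V' z"] inner_le_half_squares [of k "DV z"] by linarith
  then have "(norm z)\<^sup>2 \<le> (norm u)\<^sup>2 + (norm k)\<^sup>2"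
    using DV(2) [of z] by linarith
  then show ?thesis
    using julia [of f "U g"] k by (simp add: u_def [symmetric] z_def [symmetric])
qed

text \<open>For fixed \<open>g\<close> and \<open>y\<close> the contractivity is a family of
  inequalities in \<open>f\<close>. It is sharpest when \<open>E f - A' (U g)\<close> equals
  \<open>V' y\<close>, which completes the square; \<open>E f\<close> only approximates the required
  \<open>w\<close>, hence the closure assumption and the limit.\<close>

lemma block_contraction_necessary:
  fixes A A' E :: "'a::real_inner \<Rightarrow> 'a" and V :: "'a \<Rightarrow> 'b::real_inner"
  assumes julia: "\<And>f u. (norm (A f + E u))\<^sup>2 + (norm (E f - A' u))\<^sup>2 = (norm f)\<^sup>2 + (norm u)\<^sup>2"
    and V: "\<And>x y. inner (V x) y = inner x (V' y)"
    and cl: "V' y + A' (U g) \<in> closure (range E)"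
    and contr: "\<And>f. (norm (A f + E (U g)))\<^sup>2 + (norm (V (E f) + x))\<^sup>2 \<le> (norm f)\<^sup>2 + (norm g)\<^sup>2"
  shows "2 * inner (x + V (A' (U g))) y
    \<le> ((norm g)\<^sup>2 - (norm (U g))\<^sup>2) + ((norm y)\<^sup>2 - (norm (V' y))\<^sup>2)" (is "?l \<le> ?r")
proof -
  define w where "w = V' y + A' (U g)"
  have *: "?l \<le> (norm (E f - w))\<^sup>2 + ?r" for f
  proof -
    define p where "p = E f - A' (U g)"
    have "2 * inner (V (E f) + x) y \<le> (norm (V (E f) + x))\<^sup>2 + (norm y)\<^sup>2"
      by (rule inner_le_half_squares)
    also have "\<dots> \<le> (norm p)\<^sup>2 + (norm g)\<^sup>2 - (norm (U g))\<^sup>2 + (norm y)\<^sup>2"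
      using contr [of f] julia [of f "U g"] by (simp add: p_def)
    finally have "2 * inner (V (E f) + x) y
      \<le> (norm p)\<^sup>2 + (norm g)\<^sup>2 - (norm (U g))\<^sup>2 + (norm y)\<^sup>2" .
    moreover have "inner (V (E f) + x) y = inner p (V' y) + inner (x + V (A' (U g))) y"
      by (simp add: inner_add_left V p_def inner_diff_left)
    moreover have "(norm (E f - w))\<^sup>2 = (norm p)\<^sup>2 - 2 * inner p (V' y) + (norm (V' y))\<^sup>2"
    proof -
      have "E f - w = p - V' y" by (simp add: w_def p_def)
      then show ?thesis
        by (simp add: power2_norm_eq_inner inner_simps inner_commute)
    qed
    ultimately show ?thesis by linarith
  qed
  obtain X where X: "\<And>n. X n \<in> range E" "X \<longlonglongrightarrow> w"
    using cl closure_sequential unfolding w_def by blast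
  have "?l \<le> (norm (X n - w))\<^sup>2 + ?r" for n
    using X(1) [of n] * by auto
  moreover have "(\<lambda>n. (norm (X n - w))\<^sup>2 + ?r) \<longlonglongrightarrow> (norm (w - w))\<^sup>2 + ?r"
    by (intro tendsto_intros X(2))
  ultimately have "?l \<le> (norm (w - w))\<^sup>2 + ?r"
    by (intro LIMSEQ_le_const) auto
  then show ?thesis by simp
qed

section \<open>The operator Q\<close>

lemma bounded_ops_tendsto:
  assumes X: "X \<in> bounded_ops S R" and S: "complex_subspace S"
    and f: "\<And>n. f n \<in> S" "l \<in> S" "f \<longlonglongrightarrow> l"
  shows "(\<lambda>n. X (f n)) \<longlonglongrightarrow> X l"
proof -
  obtain C where C: "\<And>x. x \<in> S \<Longrightarrow> norm (X x) \<le> C * norm x"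
    using bounded_ops_bound [OF X] by blast
  have "(\<lambda>n. X (f n) - X l) \<longlonglongrightarrow> 0"
  proof (rule Lim_null_comparison)
    have "norm (X (f n) - X l) \<le> C * norm (f n - l)" for n
    proof -
      have d: "f n - l \<in> S" using complex_subspaceD(4) [OF S] f by (simp add: subspace_diff)
      have "X (f n - l + l) = X (f n - l) + X l"
        using X d f(2) unfolding bounded_ops_def by blast
      then have "X (f n) - X l = X (f n - l)" by simp
      then show ?thesis using C [OF d] by simp
    qed
    then show "\<forall>\<^sub>F n in sequentially. norm (X (f n) - X l) \<le> C * norm (f n - l)" by simp
    have "(\<lambda>n. C * norm (f n - l)) \<longlonglongrightarrow> C * norm (l - l)"
      by (intro tendsto_intros f)
    then show "(\<lambda>n. C * norm (f n - l)) \<longlonglongrightarrow> 0" by simp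
  qed
  then show ?thesis by (simp add: LIM_zero_cancel)
qed

text \<open>The defect operator is self-adjoint, so its kernel is orthogonal to its range: it is
  injective on the closure of the range, and projecting \<open>x\<close> there does not change the
  image.\<close>

lemma defect_space:
  fixes X :: "'a::complex_hilbert \<Rightarrow> 'b::complex_hilbert"
  assumes X: "X \<in> contractions UNIV UNIV"
  shows "complex_subspace (defect_space X)" and "closed (defect_space X)"
    and "defect X x \<in> defect_space X"
    and "u \<in> defect_space X \<Longrightarrow> v \<in> defect_space X \<Longrightarrow> defect X u = defect X v \<Longrightarrow> u = v"
    and "\<exists>h\<in>defect_space X. defect X h = defect X x"
proof -
  note D = defect [OF X]
  have lin: "linear (defect X)" using bounded_ops_UNIV(1) [OF D(1)] bounded_linear.linear by blast
  show "complex_subspace (defect_space X)"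
    unfolding defect_space_def by (rule complex_subspace_closure_range [OF D(1)])
  show "closed (defect_space X)" "defect X x \<in> defect_space X"
    using closure_subset [of "range (defect X)"] by (auto simp: defect_space_def)
  show "u = v" if "u \<in> defect_space X" "v \<in> defect_space X" "defect X u = defect X v" for u v
    using that unfolding defect_space_def
    by (intro closure_range_eqI [OF lin]) (simp_all add: D(2))
  have l: "linear (\<lambda>y. inner (defect X y) x)"
    by (intro linearI) (simp_all add: linear_add [OF lin] linear_scale [OF lin] inner_simps)
  have "inner (defect X y) x \<le> norm x * norm (defect X y)" for y
    using norm_cauchy_schwarz [of "defect X y" x] by (simp add: mult.commute)
  then obtain h where h: "h \<in> closure (range (defect X))" "\<And>y. inner (defect X y) x = inner (defect X y) h"
    by (rule riesz_along [OF lin l]) blast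
  have "inner y (defect X h - defect X x) = 0" for y
    using h(2) [of y] by (simp add: D(2) inner_diff_right)
  then have "defect X h = defect X x" using inner_eq_zero_iff eq_iff_diff_eq_0 by blast
  then show "\<exists>h\<in>defect_space X. defect X h = defect X x"
    using h(1) unfolding defect_space_def by blast
qed

lemma defect_space_sequence:
  assumes "x \<in> defect_space X"
  obtains h where "(\<lambda>n. defect X (h n)) \<longlonglongrightarrow> x"
proof -
  obtain f where "\<And>n. f n \<in> range (defect X)" "f \<longlonglongrightarrow> x"
    using assms closure_sequential unfolding defect_space_def by blast
  moreover then have "\<exists>h. \<forall>n. f n = defect X (h n)" by (meson imageE choice)
  ultimately show thesis using that by (metis (full_types) ext)
qed

context
  fixes V :: "'a::complex_hilbert \<Rightarrow> 'b::complex_hilbert" and U :: "'b \<Rightarrow> 'a"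
  assumes V: "V \<in> contractions UNIV UNIV" and U: "U \<in> contractions UNIV UNIV"
begin

lemma Vstar: "cadjoint V \<in> contractions UNIV UNIV"
  by (rule cadjoint_contraction [OF V])

text \<open>Given the factorization, every vector of \<open>range (defect U)\<close> is in the
  domain, since a preimage can be moved into \<open>defect_space U\<close>. Injectivity of
  \<open>defect (cadjoint V)\<close> on its defect space leaves only one value.\<close>

lemma Q0_eq_graph:
  assumes Q: "Q \<in> bounded_ops (defect_space U) (defect_space (cadjoint V))"
    and fact: "\<And>x. x - V (U x) = defect (cadjoint V) (Q (defect U x))"
  shows "Q0 V U = (\<lambda>f. (f, Q f)) ` range (defect U)"
proof (intro equalityI subsetI)
  have QH: "Q (defect U x) \<in> defect_space (cadjoint V)" for x
    using Q defect_space(3) [OF U] by (auto simp: bounded_ops_def)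
  show "p \<in> (\<lambda>f. (f, Q f)) ` range (defect U)" if "p \<in> Q0 V U" for p
  proof -
    obtain h g where p: "p = (defect U h, g)" and g: "g \<in> defect_space (cadjoint V)"
      "defect (cadjoint V) g = h - V (U h)"
      using \<open>p \<in> Q0 V U\<close> by (auto simp: Q0_def)
    have "g = Q (defect U h)"
      by (rule defect_space(4) [OF Vstar g(1) QH]) (simp add: g(2) fact)
    then show ?thesis using p by simp
  qed
  show "p \<in> Q0 V U" if "p \<in> (\<lambda>f. (f, Q f)) ` range (defect U)" for p
  proof -
    obtain x where p: "p = (defect U x, Q (defect U x))"
      using \<open>p \<in> (\<lambda>f. (f, Q f)) ` range (defect U)\<close> by auto
    obtain h where h: "h \<in> defect_space U" "defect U h = defect U x"
      using defect_space(5) [OF U] by blast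
    then show ?thesis
      unfolding Q0_def using p QH [of x] fact [of h]
      by (intro CollectI exI [of _ h] exI [of _ "Q (defect U x)"]) simp
  qed
qed

lemma closure_Q0:
  assumes Q: "Q \<in> bounded_ops (defect_space U) (defect_space (cadjoint V))"
    and fact: "\<And>x. x - V (U x) = defect (cadjoint V) (Q (defect U x))"
  shows "closure (Q0 V U) = {(f, Q f) |f. f \<in> defect_space U}"
proof (intro equalityI subsetI)
  note H = defect_space [OF U]
  fix p assume "p \<in> closure (Q0 V U)"
  then obtain P where P: "\<And>n. P n \<in> Q0 V U" "P \<longlonglongrightarrow> p"
    using closure_sequential by blast
  have g: "snd (P n) = Q (fst (P n))" "fst (P n) \<in> defect_space U" for n
    using P(1) [of n] H(3) by (auto simp: Q0_eq_graph [OF assms])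
  have 1: "(\<lambda>n. fst (P n)) \<longlonglongrightarrow> fst p" using P(2) by (rule tendsto_fst)
  have 2: "fst p \<in> defect_space U"
    using H(2) g(2) 1 by (meson closed_sequentially)
  have "(\<lambda>n. snd (P n)) \<longlonglongrightarrow> Q (fst p)"
    unfolding g(1) by (rule bounded_ops_tendsto [OF Q H(1) g(2) 2 1])
  then have "snd p = Q (fst p)" using tendsto_snd [OF P(2)] LIMSEQ_unique by blast
  then show "p \<in> {(f, Q f) |f. f \<in> defect_space U}"
    using 2 by (intro CollectI exI [of _ "fst p"]) (simp add: prod_eq_iff)
next
  note H = defect_space [OF U]
  fix p assume "p \<in> {(f, Q f) |f. f \<in> defect_space U}"
  then obtain f where f: "p = (f, Q f)" "f \<in> defect_space U" by blast
  obtain h where h: "(\<lambda>n. defect U (h n)) \<longlonglongrightarrow> f"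
    using defect_space_sequence [OF f(2)] by blast
  have "(\<lambda>n. Q (defect U (h n))) \<longlonglongrightarrow> Q f"
    by (rule bounded_ops_tendsto [OF Q H(1) H(3) f(2) h])
  then have "(\<lambda>n. (defect U (h n), Q (defect U (h n)))) \<longlonglongrightarrow> p"
    unfolding f(1) using h by (intro tendsto_Pair)
  then show "p \<in> closure (Q0 V U)"
    unfolding closure_sequential
    by (intro exI [of _ "\<lambda>n. (defect U (h n), Q (defect U (h n)))"])
      (auto simp: Q0_eq_graph [OF assms])
qed

text \<open>A factoring operator is determined by the closed graph, whichever one
  \<open>SOME\<close> picks. This is how an operator built from block parameters is recognized as
  the closure of \<open>Q0\<close>.\<close>

lemma Q_cl_eq:
  assumes Q: "Q \<in> bounded_ops (defect_space U) (defect_space (cadjoint V))"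
    and fact: "\<And>x. x - V (U x) = defect (cadjoint V) (Q (defect U x))"
    and x: "x \<in> defect_space U"
  shows "Q_cl V U x = Q x"
proof -
  have "\<exists>Q'. Q' \<in> bounded_ops (defect_space U) (defect_space (cadjoint V)) \<and>
     closure (Q0 V U) = {(f, Q' f) | f. f \<in> defect_space U}"
    using Q closure_Q0 [OF Q fact] by blast
  then have "closure (Q0 V U) = {(f, Q_cl V U f) | f. f \<in> defect_space U}"
    unfolding Q_cl_def by (rule someI2_ex) blast
  then have "(x, Q_cl V U x) \<in> {(f, Q f) |f. f \<in> defect_space U}"
    using closure_Q0 [OF Q fact] x by blast
  then show ?thesis by blast
qed

lemma Q_cl:
  assumes "Q0_bounded V U"
  shows "Q_cl V U \<in> bounded_ops (defect_space U) (defect_space (cadjoint V))"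
    and "x - V (U x) = defect (cadjoint V) (Q_cl V U (defect U x))"
proof -
  obtain Q where Q: "Q \<in> bounded_ops (defect_space U) (defect_space (cadjoint V))"
    "\<And>x. x - V (U x) = defect (cadjoint V) (Q (defect U x))"
    using assms unfolding Q0_bounded_def by blast
  note eq = Q_cl_eq [OF Q]
  show "Q_cl V U \<in> bounded_ops (defect_space U) (defect_space (cadjoint V))"
    using Q(1) bounded_ops_cong [OF defect_space(1) [OF U], of "Q_cl V U" Q] eq by blast
  show "x - V (U x) = defect (cadjoint V) (Q_cl V U (defect U x))"
    using Q(2) eq defect_space(3) [OF U] by simp
qed

text \<open>Boundedness makes the supremum in \<open>graph_norm\<close> genuine, and continuity
  extends the bound from the range to its closure. At the zero vector the quotient is
  \<open>0\<close> by the division convention.\<close>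

lemma norm_Q_cl_le:
  assumes bdd: "Q0_bounded V U" and x: "x \<in> defect_space U"
  shows "norm (Q_cl V U x) \<le> graph_norm (Q0 V U) * norm x"
proof -
  note Q = Q_cl [OF bdd] and H = defect_space [OF U]
  obtain C where C: "C \<ge> 0" "\<And>x. x \<in> defect_space U \<Longrightarrow> norm (Q_cl V U x) \<le> C * norm x"
    using bounded_ops_bound [OF Q(1)] by blast
  have img: "(\<lambda>(f, g). norm g / norm f) ` Q0 V U
      = (\<lambda>f. norm (Q_cl V U f) / norm f) ` range (defect U)"
    by (simp add: Q0_eq_graph [OF Q] image_image)
  have "norm (Q_cl V U (defect U y)) / norm (defect U y) \<le> C" for y
    using C(2) [OF H(3) [of y]] C(1) by (cases "norm (defect U y) = 0") (simp_all add: divide_le_eq)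
  then have bdd: "bdd_above ((\<lambda>f. norm (Q_cl V U f) / norm f) ` range (defect U))"
    by (intro bdd_aboveI [of _ C]) auto
  have le: "norm (Q_cl V U (defect U y)) \<le> graph_norm (Q0 V U) * norm (defect U y)" for y
  proof (cases "defect U y = 0")
    case True
    then have "norm (Q_cl V U (defect U y)) \<le> 0" using C(2) [OF H(3) [of y]] by simp
    then show ?thesis using True by simp
  next
    case False
    have "norm (Q_cl V U (defect U y)) / norm (defect U y) \<le> graph_norm (Q0 V U)"
      unfolding graph_norm_def img by (intro cSUP_upper bdd) auto
    then show ?thesis using False by (simp add: divide_le_eq)
  qed
  obtain h where h: "(\<lambda>n. defect U (h n)) \<longlonglongrightarrow> x"
    using defect_space_sequence [OF x] by blast
  have "(\<lambda>n. Q_cl V U (defect U (h n))) \<longlonglongrightarrow> Q_cl V U x"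
    by (rule bounded_ops_tendsto [OF Q(1) H(1) H(3) x h])
  then show ?thesis
    using le by (intro LIMSEQ_le [OF tendsto_norm tendsto_mult_left [OF tendsto_norm [OF h]]]) auto
qed

lemma graph_norm_Q0_le:
  assumes bdd: "Q0_bounded V U" and "\<And>x. x \<in> defect_space U \<Longrightarrow> norm (Q_cl V U x) \<le> C * norm x"
    and "C \<ge> 0"
  shows "graph_norm (Q0 V U) \<le> C"
  unfolding graph_norm_def
proof (rule cSUP_least)
  show "Q0 V U \<noteq> {}" by (simp add: Q0_eq_graph [OF Q_cl [OF bdd]])
  fix p assume "p \<in> Q0 V U"
  then obtain y where "p = (defect U y, Q_cl V U (defect U y))"
    by (auto simp: Q0_eq_graph [OF Q_cl [OF bdd]])
  then show "(case p of (f, g) \<Rightarrow> norm g / norm f) \<le> C"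
    using assms(2) [OF defect_space(3) [OF U, of y]] assms(3)
    by (cases "norm (defect U y) = 0") (simp_all add: divide_le_eq)
qed

text \<open>If \<open>\<parallel>Q\<parallel> < 1\<close>, pairing \<open>I - V U\<close> with \<open>(x, x)\<close> forces \<open>D\<^sub>U x = 0\<close> for every \<open>x\<close>.\<close>

lemma graph_norm_Q0_ge_1:
  assumes bdd: "Q0_bounded V U" and ne: "defect_space U \<noteq> {0}"
  shows "1 \<le> graph_norm (Q0 V U)"
proof (rule ccontr)
  define n where "n = graph_norm (Q0 V U)"
  assume "\<not> 1 \<le> graph_norm (Q0 V U)"
  then have "n < 1" by (simp add: n_def)
  note DU = defect [OF U] and DV = defect [OF Vstar]
  have Vb: "V \<in> bounded_ops UNIV UNIV" using V by (simp add: contractions_def)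
  have "defect U x = 0" for x
  proof -
    define a b where "a = norm (defect U x)" and "b = norm (defect (cadjoint V) x)"
    have "(norm x)\<^sup>2 = inner (V (U x)) x + inner (defect (cadjoint V) (Q_cl V U (defect U x))) x"
      by (simp add: Q_cl(2) [OF bdd, symmetric] inner_diff_left power2_norm_eq_inner)
    also have "inner (V (U x)) x = inner (U x) (cadjoint V x)"
      by (rule cadjoint(3) [OF Vb])
    also have "inner (defect (cadjoint V) (Q_cl V U (defect U x))) x
        = inner (Q_cl V U (defect U x)) (defect (cadjoint V) x)" by (rule DV(2))
    also have "\<dots> \<le> norm (Q_cl V U (defect U x)) * b"
      unfolding b_def by (rule norm_cauchy_schwarz)
    also have "\<dots> \<le> (n * a) * b"
      using norm_Q_cl_le [OF bdd defect_space(3) [OF U, of x]]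
      by (intro mult_right_mono) (auto simp: n_def a_def b_def)
    finally have "2 * (norm x)\<^sup>2 \<le> (norm (U x))\<^sup>2 + (norm (cadjoint V x))\<^sup>2 + 2 * (n * a * b)"
      using inner_le_half_squares [of "U x" "cadjoint V x"] by simp
    \<comment> \<open>The defect identities express \<open>norm (U x)\<close> and
      \<open>norm (cadjoint V x)\<close> through \<open>norm x\<close>, which cancels. With
      \<open>n < 1\<close> the result is compatible with \<open>ge\<close> only if
      \<open>a = b = 0\<close>.\<close>
    then have le: "a\<^sup>2 + b\<^sup>2 \<le> 2 * (n * (a * b))"
      using DU(4) [of x] DV(4) [of x] by (simp add: a_def b_def mult.assoc)
    have ge: "2 * (a * b) \<le> a\<^sup>2 + b\<^sup>2"
      using zero_le_power2 [of "a - b"] by (simp add: power2_diff mult.assoc)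
    have "0 \<le> a * b" by (simp add: a_def b_def)
    moreover have "(1 - n) * (a * b) \<le> 0" using le ge by (simp add: algebra_simps)
    ultimately have "a * b = 0"
      using \<open>n < 1\<close> by (smt (verit) mult_pos_pos)
    then have "a\<^sup>2 + b\<^sup>2 \<le> 0" using le by (simp only: mult_zero_right)
    then have "a = 0" by (simp add: sum_power2_le_zero_iff)
    then show ?thesis by (simp add: a_def)
  qed
  then have "range (defect U) = {0}" by auto
  then show False using ne by (simp add: defect_space_def)
qed

text \<open>At \<open>\<phi> = pi / 2\<close> the condition holds even if \<open>Q0\<close> is
  unbounded, whence the disjunct \<open>cos \<phi> = 0\<close>; for smaller angles it is the norm
  bound on \<open>Q cos \<phi>\<close>.\<close>

lemma phi1_le_iff:
  assumes \<phi>: "0 < \<phi>" "\<phi> \<le> pi / 2"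
  shows "phi1 V U \<le> \<phi> \<longleftrightarrow> cos \<phi> = 0 \<or>
    Q0_bounded V U \<and> (\<forall>x\<in>defect_space U. cos \<phi> * norm (Q_cl V U x) \<le> norm x)"
proof -
  have c0: "cos \<phi> \<ge> 0" using \<phi> by (intro cos_ge_zero) auto
  have cpi: "cos \<phi> = 0 \<longleftrightarrow> \<phi> = pi / 2"
    using \<phi> cos_gt_zero [of \<phi>] cos_pi_half by (metis less_le order_less_irrefl)
  consider "\<not> Q0_bounded V U"
    | "Q0_bounded V U" "defect_space U = {0} \<or> defect_space (cadjoint V) = {0}"
    | "Q0_bounded V U" "defect_space U \<noteq> {0}" "defect_space (cadjoint V) \<noteq> {0}" by blast
  then show ?thesis
  proof cases
    case 1
    then show ?thesis using \<phi> by (auto simp: phi1_def cpi)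
  next
    case 2
    obtain C where C: "\<And>x. x \<in> defect_space U \<Longrightarrow> norm (Q_cl V U x) \<le> C * norm x"
      using bounded_ops_bound [OF Q_cl(1) [OF 2(1)]] by blast
    \<comment> \<open>With a trivial defect space \<open>Q\<close> vanishes and every angle is
      admissible, matching the value \<open>0\<close> of \<open>phi1\<close>.\<close>
    have "Q_cl V U x = 0" if x: "x \<in> defect_space U" for x
      using 2(2)
    proof
      assume "defect_space U = {0}"
      then show ?thesis using C [OF x] x by simp
    next
      assume "defect_space (cadjoint V) = {0}"
      then show ?thesis using Q_cl(1) [OF 2(1)] x by (auto simp: bounded_ops_def)
    qed
    then show ?thesis using 2 \<phi> by (auto simp: phi1_def)
  next
    case 3
    define n where "n = graph_norm (Q0 V U)"
    have n: "1 \<le> n" using graph_norm_Q0_ge_1 3 by (simp add: n_def)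
    \<comment> \<open>Norm at least one puts the inverse into the domain of \<open>arccos\<close>,
      where \<open>arccos\<close> reverses order.\<close>
    then have in1: "0 < inverse n" "inverse n \<le> 1" by (auto simp: inverse_le_1_iff)
    have "phi1 V U \<le> \<phi> \<longleftrightarrow> arccos (inverse n) \<le> arccos (cos \<phi>)"
      using 3 \<phi> by (simp add: phi1_def n_def arccos_cos)
    also have "\<dots> \<longleftrightarrow> cos \<phi> \<le> inverse n"
      using in1 by (intro arccos_le_mono) auto
    also have "\<dots> \<longleftrightarrow> cos \<phi> * n \<le> 1"
      using n by (simp add: field_simps)
    also have "\<dots> \<longleftrightarrow> cos \<phi> = 0 \<or> (\<forall>x\<in>defect_space U. cos \<phi> * norm (Q_cl V U x) \<le> norm x)"
    proof (intro iffI disjI2 ballI)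
      fix x assume le: "cos \<phi> * n \<le> 1" and x: "x \<in> defect_space U"
      have "cos \<phi> * norm (Q_cl V U x) \<le> cos \<phi> * (n * norm x)"
        unfolding n_def using norm_Q_cl_le 3 x c0 by (intro mult_left_mono) auto
      also have "\<dots> \<le> 1 * norm x"
        unfolding mult.assoc [symmetric] using le by (intro mult_right_mono) auto
      finally show "cos \<phi> * norm (Q_cl V U x) \<le> norm x" by simp
    next
      assume *: "cos \<phi> = 0 \<or> (\<forall>x\<in>defect_space U. cos \<phi> * norm (Q_cl V U x) \<le> norm x)"
      show "cos \<phi> * n \<le> 1"
      proof (cases "cos \<phi> = 0")
        case False
        then have "cos \<phi> > 0" using c0 by simp
        then have "n \<le> inverse (cos \<phi>)"
          unfolding n_def using * 3 False
          by (intro graph_norm_Q0_le) (auto simp: field_simps)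
        then show ?thesis using \<open>cos \<phi> > 0\<close> by (simp add: field_simps)
      qed simp
    qed
    finally show ?thesis using 3 by simp
  qed
qed

end

section \<open>Extensions as contractive blocks\<close>

lemma onorm_le_1_iff:
  assumes "bounded_linear F"
  shows "onorm F \<le> 1 \<longleftrightarrow> (\<forall>x. norm (F x) \<le> norm x)"
proof
  show "\<forall>x. norm (F x) \<le> norm x" if "onorm F \<le> 1"
    using onorm [OF assms] mult_right_mono [OF that norm_ge_zero] by (metis mult_1 order_trans)
  show "onorm F \<le> 1" if "\<forall>x. norm (F x) \<le> norm x"
    using onorm_bound [of 1 F] that by simp
qed

text \<open>Packing both signs into \<open>\<kappa>\<close> lets a single block criterion serve both
  conditions.\<close>

lemma C_class_iff:
  assumes T: "T \<in> bounded_ops UNIV UNIV"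
  shows "T \<in> C_class \<phi> \<longleftrightarrow>
    (\<forall>\<kappa>\<in>{cos \<phi>, - cos \<phi>}. \<forall>x. norm (sin \<phi> *\<^sub>R T x + (\<i> * complex_of_real \<kappa>) *\<^sub>C x) \<le> norm x)"
proof -
  have id: "(\<lambda>x. x) \<in> bounded_ops UNIV UNIV"
    by (intro bounded_ops_UNIV_I bounded_linear_ident) simp
  have b: "bounded_linear (\<lambda>x. sin \<phi> *\<^sub>R T x + (\<i> * complex_of_real \<kappa>) *\<^sub>C x)" for \<kappa>
    using T id by (intro bounded_ops_UNIV(1) bounded_ops_add bounded_ops_scaleR bounded_ops_scaleC) auto
  show ?thesis
    unfolding C_class_def using T onorm_le_1_iff [OF b [of "cos \<phi>"]] onorm_le_1_iff [OF b [of "- cos \<phi>"]]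
    by (simp add: scaleC_minus_left)
qed

lemma bounded_ops_compose:
  assumes "F \<in> bounded_ops UNIV UNIV" "G \<in> bounded_ops UNIV UNIV"
  shows "(\<lambda>x. F (G x)) \<in> bounded_ops UNIV UNIV"
  by (rule bounded_ops_UNIV_I [OF bounded_linear_compose [OF assms [THEN bounded_ops_UNIV(1)]]])
    (simp add: assms [THEN bounded_ops_UNIV(2)])

lemma block_op_bounded_ops:
  assumes "A11 \<in> bounded_ops UNIV UNIV" "A12 \<in> bounded_ops UNIV UNIV"
    "A21 \<in> bounded_ops UNIV UNIV" "A22 \<in> bounded_ops UNIV UNIV"
  shows "block_op A11 A12 A21 A22 \<in> bounded_ops UNIV UNIV"
proof (rule bounded_ops_UNIV_I)
  note B = assms [THEN bounded_ops_UNIV(1)] and C = assms [THEN bounded_ops_UNIV(2)]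
  have eq: "block_op A11 A12 A21 A22
      = (\<lambda>x. (A11 (fst x) + A12 (snd x), A21 (fst x) + A22 (snd x)))"
    by (auto simp: block_op_def fun_eq_iff)
  show "bounded_linear (block_op A11 A12 A21 A22)"
    unfolding eq
    by (intro bounded_linear_Pair bounded_linear_add
        B [THEN bounded_linear_compose] bounded_linear_fst bounded_linear_snd)
  show "block_op A11 A12 A21 A22 (a *\<^sub>C x) = a *\<^sub>C block_op A11 A12 A21 A22 x" for a x
    by (simp add: eq scaleC_prod_def C scaleC_add_right)
qed

text \<open>The condition on the adjoint, paired with vectors \<open>(h, 0)\<close>, fixes the upper
  right entry; only the lower right entry stays free.\<close>

lemma extensions_iff:
  fixes T1 T2 :: "'a::complex_hilbert \<Rightarrow> 'a \<times> 'b::complex_hilbert"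
    and T12 :: "'b \<Rightarrow> 'a" and T21 :: "'a \<Rightarrow> 'b"
  assumes T11: "T11 \<in> bounded_ops UNIV UNIV" "cadjoint T11 = T11"
    and T12: "T12 \<in> bounded_ops UNIV UNIV" and T21: "T21 \<in> bounded_ops UNIV UNIV"
    and T1: "\<And>f. T1 f = (T11 f, T21 f)"
    and T2: "\<And>f. T2 f = (T11 f, cadjoint T12 f)"
  shows "T \<in> extensions T1 T2 \<longleftrightarrow>
    (\<exists>T22\<in>bounded_ops UNIV UNIV. T = block_op T11 T12 T21 T22)"
proof
  assume "T \<in> extensions T1 T2"
  then have T: "T \<in> bounded_ops UNIV UNIV" "\<And>f. T (f, 0) = T1 f" "\<And>f. cadjoint T (f, 0) = T2 f"
    by (auto simp: extensions_def)
  note Tl = bounded_ops_UNIV [OF T(1)]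
  define T22 where "T22 g = snd (T (0, g))" for g
  have "T22 \<in> bounded_ops UNIV UNIV"
  proof (rule bounded_ops_UNIV_I)
    show "bounded_linear T22"
      unfolding T22_def
      by (intro bounded_linear_compose [OF bounded_linear_snd] bounded_linear_compose [OF Tl(1)]
          bounded_linear_Pair bounded_linear_zero bounded_linear_ident)
    show "T22 (a *\<^sub>C x) = a *\<^sub>C T22 x" for a x
      using Tl(2) [of a "(0, x)"] by (simp add: T22_def scaleC_prod_def)
  qed
  moreover have "T = block_op T11 T12 T21 T22"
  proof
    fix x :: "'a \<times> 'b"
    obtain f g where x: "x = (f, g)" by (cases x)
    have "inner (fst (T (0, g)) - T12 g) h = 0" for h
    proof -
      have "inner (fst (T (0, g))) h = inner (T (0, g)) (h, 0)" by (simp add: inner_prod_def)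
      also have "\<dots> = inner (0, g) (T2 h)" by (simp add: cadjoint(3) [OF T(1)] T(3))
      also have "\<dots> = inner (T12 g) h" by (simp add: T2 inner_prod_def cadjoint(3) [OF T12])
      finally show ?thesis by (simp add: inner_diff_left)
    qed
    then have 12: "fst (T (0, g)) = T12 g" using inner_eq_zero_iff eq_iff_diff_eq_0 by blast
    have "T x = T (f, 0) + T (0, g)"
      using linear_add [OF bounded_linear.linear [OF Tl(1)], of "(f, 0)" "(0, g)"] by (simp add: x)
    also have "\<dots> = block_op T11 T12 T21 T22 x"
      by (simp add: T(2) T1 x block_op_def prod_eq_iff 12 T22_def)
    finally show "T x = block_op T11 T12 T21 T22 x" .
  qed
  ultimately show "\<exists>T22\<in>bounded_ops UNIV UNIV. T = block_op T11 T12 T21 T22" by blast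
next
  assume "\<exists>T22\<in>bounded_ops UNIV UNIV. T = block_op T11 T12 T21 T22"
  then obtain T22 where T22: "T22 \<in> bounded_ops UNIV UNIV" and T: "T = block_op T11 T12 T21 T22"
    by blast
  have Tb: "T \<in> bounded_ops UNIV UNIV"
    unfolding T by (intro block_op_bounded_ops T11(1) T12 T21 T22)
  have z: "T12 0 = 0" "T22 0 = 0" "cadjoint T21 0 = 0" "cadjoint T22 0 = 0"
    using T12 T22 cadjoint(1) [OF T21] cadjoint(1) [OF T22]
    by (auto dest!: bounded_ops_UNIV(1) intro: linear_0 bounded_linear.linear)
  have "cadjoint T = (\<lambda>(f, g). (T11 f + cadjoint T21 g, cadjoint T12 f + cadjoint T22 g))"
    using cadjoint(3) [OF T11(1)] cadjoint(3) [OF T12] cadjoint(3) [OF T21] cadjoint(3) [OF T22] T11(2)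
    by (intro cadjoint_eqI [OF Tb])
      (auto simp: T block_op_def inner_prod_def inner_add_left inner_add_right)
  then show "T \<in> extensions T1 T2"
    using Tb z by (simp add: extensions_def T2) (simp add: T T1 block_op_def)
qed

text \<open>With \<open>A = \<sigma> T\<^sub>1\<^sub>1 + i \<kappa>\<close> and \<open>\<sigma>\<^sup>2 + \<kappa>\<^sup>2 = 1\<close> the defect operators of \<open>A\<close> and \<open>A*\<close> are both \<open>\<sigma> D\<close>,
  where \<open>D\<close> is the defect operator of \<open>T\<^sub>1\<^sub>1\<close>.\<close>

lemma shifted_block_contraction_iff:
  fixes T11 :: "'a::complex_hilbert \<Rightarrow> 'a" and V :: "'a \<Rightarrow> 'b::complex_hilbert" and U :: "'b \<Rightarrow> 'a"
  assumes T11: "T11 \<in> contractions UNIV UNIV" "cadjoint T11 = T11"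
    and T12: "\<And>g. T12 g = defect T11 (U g)" and T21: "\<And>f. T21 f = V (defect T11 f)"
    and V: "V \<in> contractions UNIV UNIV" "op_kernel (defect T11) \<subseteq> op_kernel V"
    and U: "U \<in> contractions UNIV UNIV" "op_kernel (defect T11) \<subseteq> op_kernel (cadjoint U)"
    and T22: "T22 \<in> bounded_ops UNIV UNIV"
    and \<sigma>: "\<sigma> > 0" "\<sigma>\<^sup>2 + \<kappa>\<^sup>2 = 1"
  shows "(\<forall>x. norm (\<sigma> *\<^sub>R block_op T11 T12 T21 T22 x + (\<i> * complex_of_real \<kappa>) *\<^sub>C x) \<le> norm x) \<longleftrightarrow>
    (\<exists>K \<in> contractions (defect_space U) (defect_space (cadjoint V)).
      \<forall>g. \<sigma> *\<^sub>R (T22 g + V (T11 (U g))) + (\<i> * complex_of_real \<kappa>) *\<^sub>C (g - V (U g))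
        = defect (cadjoint V) (K (defect U g)))"
proof -
  define k where "k = \<i> * complex_of_real \<kappa>"
  have kk: "k * k = - complex_of_real (\<kappa>\<^sup>2)" "cnj k = - k"
    by (simp_all add: k_def complex_eq_iff power2_eq_square)
  define D where "D = defect T11"
  define A where "A f = \<sigma> *\<^sub>R T11 f + k *\<^sub>C f" for f
  define A' where "A' f = \<sigma> *\<^sub>R T11 f - k *\<^sub>C f" for f
  define E where "E f = \<sigma> *\<^sub>R D f" for f
  have bd: "T11 \<in> bounded_ops UNIV UNIV" "V \<in> bounded_ops UNIV UNIV" "U \<in> bounded_ops UNIV UNIV"
    using T11 V U by (auto simp: contractions_def)
  note DT = defect [OF T11(1), folded D_def, unfolded T11(2)]
  note Vs = cadjoint_contraction [OF V(1)]
  note DU = defect [OF U(1)] and DV = defect [OF Vs]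
  note Tsc = bounded_ops_UNIV(2) [OF bd(1)] and Vsc = bounded_ops_UNIV(2) [OF bd(2)]
    and Usc = bounded_ops_UNIV(2) [OF bd(3)] and Dsc = bounded_ops_UNIV(2) [OF DT(1)]
  note lT = bounded_linear.linear [OF bounded_ops_UNIV(1) [OF bd(1)]]
    and lV = bounded_linear.linear [OF bounded_ops_UNIV(1) [OF bd(2)]]
    and lU = bounded_linear.linear [OF bounded_ops_UNIV(1) [OF bd(3)]]
    and lD = bounded_linear.linear [OF bounded_ops_UNIV(1) [OF DT(1)]]
  have Tsym: "inner (T11 x) y = inner x (T11 y)" for x y
    using cadjoint(3) [OF bd(1), of x y] T11(2) by simp
  have TD: "T11 (D x) = D (T11 x)" for x
    by (rule DT(5)) (use bounded_ops_UNIV(1) [OF bd(1)] in auto)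
  have adj: "inner (A x) y = inner x (A' y)" for x y
    by (simp add: A_def A'_def inner_add_left inner_diff_right Tsym inner_scaleC_left kk scaleC_minus_left)
  have Esym: "inner (E x) y = inner x (E y)" for x y
    by (simp add: E_def DT(2))
  have AE: "A (E x) = E (A x)" for x
    by (simp add: A_def E_def linear_add [OF lD] linear_scale [OF lD] linear_scale [OF lT]
        TD Dsc scaleR_add_right scaleC_scaleR_commute)
  have EE: "x - E (E x) = (\<sigma> * \<sigma>) *\<^sub>R T11 (T11 x) + (\<kappa>\<^sup>2) *\<^sub>R x" for x
  proof -
    have "E (E x) = (\<sigma> * \<sigma>) *\<^sub>R x - (\<sigma> * \<sigma>) *\<^sub>R T11 (T11 x)"
      by (simp add: E_def linear_scale [OF lD] DT(3) scaleR_diff_right)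
    moreover have "\<kappa>\<^sup>2 *\<^sub>R x = x - (\<sigma> * \<sigma>) *\<^sub>R x"
    proof -
      have "\<kappa>\<^sup>2 = 1 - \<sigma> * \<sigma>" using \<sigma>(2) by (simp add: power2_eq_square)
      then show ?thesis by (simp add: scaleR_diff_left)
    qed
    ultimately show ?thesis by simp
  qed
  have kkx: "k *\<^sub>C k *\<^sub>C x = - (\<kappa>\<^sup>2 *\<^sub>R x)" for x :: 'a
    by (simp add: scaleC_scaleC kk scaleC_minus_left scaleR_scaleC)
  \<comment> \<open>The mixed terms cancel because scalars commute with \<open>T11\<close>, and
    \<open>- k * k\<close> contributes \<open>\<kappa>\<^sup>2\<close>.\<close>
  have AA: "A' (A x) = x - E (E x)" "A (A' x) = x - E (E x)" for x
    unfolding EE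
    by (simp_all add: A_def A'_def linear_add [OF lT] linear_diff [OF lT] linear_scale [OF lT] Tsc
        scaleR_add_right scaleR_diff_right scaleC_add_right scaleC_diff_right scaleC_scaleR_commute kkx)
  note julia = julia_isometric [of A A' E, OF adj Esym AE AA]
  have lE: "linear E"
    by (intro linearI) (simp_all add: E_def linear_add [OF lD] linear_scale [OF lD] scaleR_add_right)
  have Ez: "D z = 0" if "E z = 0" for z
    using that \<sigma>(1) by (simp add: E_def)
  \<comment> \<open>It suffices to test against \<open>z\<close> in the kernel of \<open>D\<close>.
    That kernel is invariant under \<open>A\<close>, as \<open>T11\<close> and \<open>D\<close>
    commute, so the kernel condition on \<open>U\<close> applies to \<open>A z\<close>.\<close>
  have clU: "A' (U g) \<in> closure (range E)" for g
  proof (rule in_closure_range_selfadjoint [OF lE Esym])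
    fix z assume "E z = 0"
    then have "D z = 0" by (rule Ez)
    then have "D (A z) = 0"
      by (simp add: A_def linear_add [OF lD] linear_scale [OF lD] Dsc TD [symmetric] linear_0 [OF lT])
    then have "cadjoint U (A z) = 0" using U(2) by (auto simp: op_kernel_def D_def)
    then show "inner (A' (U g)) z = 0"
      by (metis adj cadjoint(3) [OF bd(3)] inner_commute inner_zero_right)
  qed
  have clV: "cadjoint V y \<in> closure (range E)" for y
  proof (rule in_closure_range_selfadjoint [OF lE Esym])
    fix z assume "E z = 0"
    then have "V z = 0" using Ez V(2) by (auto simp: op_kernel_def D_def)
    then show "inner (cadjoint V y) z = 0"
      by (metis cadjoint(3) [OF bd(2)] inner_commute inner_zero_right)
  qed
  have cl: "cadjoint V y + A' (U g) \<in> closure (range E)" for y g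
    by (rule subspace_add [OF subspace_closure_range [OF lE] clV clU])
  \<comment> \<open>\<open>X\<close> is the lower right entry of the shifted block and
    \<open>Y\<close> its deviation from \<open>- V A' U\<close>, the term that must factor through
    the defect operators.\<close>
  define X where "X g = \<sigma> *\<^sub>R T22 g + k *\<^sub>C g" for g
  define Y where "Y g = X g + V (A' (U g))" for g
  have Yeq: "Y g = \<sigma> *\<^sub>R (T22 g + V (T11 (U g))) + k *\<^sub>C (g - V (U g))" for g
    by (simp add: Y_def X_def A'_def linear_diff [OF lV] linear_scale [OF lV] Vsc
        scaleR_add_right scaleC_diff_right)
  have blk: "\<sigma> *\<^sub>R block_op T11 T12 T21 T22 (f, g) + k *\<^sub>C (f, g)
      = (A f + E (U g), V (E f) + X g)" for f g
    by (simp add: block_op_def A_def E_def X_def T12 T21 D_def [symmetric] scaleC_prod_def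
        linear_scale [OF lV] scaleR_add_right)
  have contr: "(\<forall>x. norm (\<sigma> *\<^sub>R block_op T11 T12 T21 T22 x + k *\<^sub>C x) \<le> norm x) \<longleftrightarrow>
    (\<forall>f g. (norm (A f + E (U g)))\<^sup>2 + (norm (V (E f) + X g))\<^sup>2 \<le> (norm f)\<^sup>2 + (norm g)\<^sup>2)"
    by (simp add: split_paired_All blk norm_Pair)
  show ?thesis
    unfolding k_def [symmetric] contr Yeq [symmetric]
  proof
    assume c: "\<forall>f g. (norm (A f + E (U g)))\<^sup>2 + (norm (V (E f) + X g))\<^sup>2 \<le> (norm f)\<^sup>2 + (norm g)\<^sup>2"
    have half: "2 * inner (Y g) y \<le> (norm (defect U g))\<^sup>2 + (norm (defect (cadjoint V) y))\<^sup>2" for g y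
      using block_contraction_necessary [where A = A and A' = A' and E = E and V = V and U = U,
          OF julia cadjoint(3) [OF bd(2)] cl, of g "X g" y] c
      by (simp add: Y_def DU(4) DV(4))
    have id: "(\<lambda>x. x) \<in> bounded_ops UNIV UNIV"
      by (intro bounded_ops_UNIV_I bounded_linear_ident) simp
    have Yb: "Y \<in> bounded_ops UNIV UNIV"
      unfolding Yeq
      by (intro bounded_ops_add bounded_ops_scaleR bounded_ops_scaleC bounded_ops_diff
          complex_subspace_UNIV bounded_ops_compose [OF bd(2)] bounded_ops_compose [OF bd(1)] id T22 bd)
    note lY = bounded_linear.linear [OF bounded_ops_UNIV(1) [OF Yb]]
    \<comment> \<open>Scaling \<open>g\<close> by \<open>t\<close> and \<open>y\<close> by
      \<open>1 / t\<close> leaves the left side of \<open>half\<close> unchanged; optimizing in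
      \<open>t\<close> gives the product.\<close>
    have bound: "inner (Y g) y \<le> norm (defect U g) * norm (defect (cadjoint V) y)" for g y
    proof (rule le_mult_of_le_scaled_squares)
      fix t :: real assume t: "t > 0"
      have "linear (defect U)" "linear (defect (cadjoint V))"
        using DU(1) DV(1) bounded_ops_UNIV(1) bounded_linear.linear by blast+
      note sc = linear_scale [OF this(1)] linear_scale [OF this(2)]
      show "2 * inner (Y g) y
          \<le> (t * norm (defect U g))\<^sup>2 + (norm (defect (cadjoint V) y) / t)\<^sup>2"
        using half [of "t *\<^sub>R g" "(1 / t) *\<^sub>R y"] t
        by (simp add: linear_scale [OF lY] sc)
    qed auto
    show "\<exists>K\<in>contractions (defect_space U) (defect_space (cadjoint V)).
        \<forall>g. Y g = defect (cadjoint V) (K (defect U g))"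
      unfolding defect_space_def
      by (rule douglas_factorization [OF DU(1) DV(1,2) Yb bound]) blast
  next
    assume "\<exists>K\<in>contractions (defect_space U) (defect_space (cadjoint V)).
        \<forall>g. Y g = defect (cadjoint V) (K (defect U g))"
    then obtain K where K: "K \<in> contractions (defect_space U) (defect_space (cadjoint V))"
      "\<And>g. Y g = defect (cadjoint V) (K (defect U g))" by blast
    show "\<forall>f g. (norm (A f + E (U g)))\<^sup>2 + (norm (V (E f) + X g))\<^sup>2 \<le> (norm f)\<^sup>2 + (norm g)\<^sup>2"
    proof (intro allI)
      fix f g
      have "norm (K (defect U g)) \<le> norm (defect U g)"
        using K(1) defect_space(3) [OF U(1)] by (auto simp: contractions_def)
      then have k: "(norm (K (defect U g)))\<^sup>2 \<le> (norm g)\<^sup>2 - (norm (U g))\<^sup>2"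
        unfolding DU(4) [symmetric] by (rule power_mono) simp
      have e: "V (E f) + X g = V (E f - A' (U g)) + defect (cadjoint V) (K (defect U g))"
        unfolding K(2) [symmetric] by (simp add: Y_def linear_diff [OF lV])
      show "(norm (A f + E (U g)))\<^sup>2 + (norm (V (E f) + X g))\<^sup>2 \<le> (norm f)\<^sup>2 + (norm g)\<^sup>2"
        unfolding e
        by (rule block_contraction
            [where A = A and A' = A' and E = E and V = V and V' = "cadjoint V"
              and DV = "defect (cadjoint V)" and U = U, OF julia cadjoint(3) [OF bd(2)] DV(2) DV(4) k])
    qed
  qed
qed

section \<open>The parametrization\<close>

text \<open>Where \<open>W\<close> preserves the norm of \<open>z\<close>, the parallelogram law
  leaves no room for \<open>K z\<close>. An isometric \<open>W\<close> does so everywhere, a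
  coisometric one on the vectors \<open>A y\<close>; from these the equality case for the
  contraction \<open>F\<close> reaches arbitrary \<open>x\<close>.\<close>

lemma maximal_partial_isometry_rigid:
  fixes W K :: "'a::complex_hilbert \<Rightarrow> 'b::complex_inner"
  assumes S: "complex_subspace S" "closed S" and R: "complex_subspace R"
    and W: "maximal_partial_isometry S R W" and K: "K \<in> bounded_ops S R" and s: "s > 0"
    and plus: "(\<lambda>x. s *\<^sub>R K x + \<i> *\<^sub>C W x) \<in> contractions S R"
    and minus: "(\<lambda>x. s *\<^sub>R K x - \<i> *\<^sub>C W x) \<in> contractions S R"
    and x: "x \<in> S"
  shows "K x = 0"
proof -
  note Sr = complex_subspaceD [OF S(1)] and Rr = complex_subspaceD [OF R]
  define A where "A = adjoint_on S R W"
  have Wb: "W \<in> bounded_ops S R" using W by (simp add: maximal_partial_isometry_def)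
  have A: "A y \<in> S" "inner (W x) y = inner x (A y)" if "x \<in> S" "y \<in> R" for x y
  proof -
    note adj = adjoint_on [OF S R Wb, folded A_def]
    show "A y \<in> S" using adj(1) that by (auto simp: bounded_ops_def)
    show "inner (W x) y = inner x (A y)"
      using arg_cong [OF adj(2) [OF that], of Re] by (simp add: Re_cinner)
  qed
  have WR: "W x \<in> R" and KR: "K x \<in> R" if "x \<in> S" for x
    using Wb K that by (auto simp: bounded_ops_def)
  have attained: "K z = 0" if z: "z \<in> S" and "norm (W z) = norm z" for z
  proof -
    have "(norm (s *\<^sub>R K z + \<i> *\<^sub>C W z))\<^sup>2 \<le> (norm z)\<^sup>2" "(norm (s *\<^sub>R K z - \<i> *\<^sub>C W z))\<^sup>2 \<le> (norm z)\<^sup>2"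
      using plus minus z by (auto simp: contractions_def intro!: power_mono)
    moreover have "(norm (\<i> *\<^sub>C W z))\<^sup>2 = (norm z)\<^sup>2" using that(2) by (simp add: norm_scaleC)
    ultimately have "(norm (s *\<^sub>R K z))\<^sup>2 \<le> 0"
      unfolding power2_norm_eq_inner inner_add_left inner_add_right inner_diff_left inner_diff_right
      by linarith
    then show ?thesis using s by simp
  qed
  consider "\<forall>x\<in>S. A (W x) = x" | "\<forall>y\<in>R. W (A y) = y"
    using W unfolding maximal_partial_isometry_def A_def by blast
  then show ?thesis
  proof cases
    case 1
    have "inner (W x) (W x) = inner x x" using A(2) [OF x WR [OF x]] 1 x by simp
    then show ?thesis using attained [OF x] by (simp add: norm_eq_sqrt_inner)
  next
    case 2
    define F where "F x = s *\<^sub>R K x + \<i> *\<^sub>C W x" for x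
    have Fb: "F \<in> bounded_ops S R" and Fn: "\<And>x. x \<in> S \<Longrightarrow> norm (F x) \<le> norm x"
      using plus by (auto simp: contractions_def F_def [abs_def])
    have "inner (\<i> *\<^sub>C y) (K x) = 0" if y: "y \<in> R" for y
    proof -
      define z where "z = A y"
      have z: "z \<in> S" "W z = y" using A(1) [OF x y] 2 y by (auto simp: z_def)
      have "inner z z = inner y y" using A(2) [OF z(1) y] z by (simp add: z_def)
      then have "K z = 0" using z by (intro attained) (auto simp: norm_eq_sqrt_inner)
      then have Fz: "F z = \<i> *\<^sub>C y" using z by (simp add: F_def)
      have nz: "inner (F z) (F z) = inner z z"
        using \<open>inner z z = inner y y\<close> by (simp add: Fz inner_scaleC_left scaleC_scaleC)
      \<comment> \<open>A contraction preserving the norm of \<open>z\<close> preserves all inner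
        products with \<open>z\<close>: the loss of squared norm along \<open>z + t x\<close> is
        nonnegative and vanishes at \<open>t = 0\<close>.\<close>
      have "0 \<le> 2 * t * (inner z x - inner (F z) (F x)) + t\<^sup>2 * (inner x x - inner (F x) (F x))" for t
      proof -
        have tx: "t *\<^sub>R x \<in> S" using Sr(4) x by (simp add: subspace_scale)
        have "F (z + t *\<^sub>R x) = F z + F (t *\<^sub>R x)"
          using Fb z(1) tx unfolding bounded_ops_def by blast
        also have "F (t *\<^sub>R x) = t *\<^sub>R F x"
          using Fb x by (simp add: bounded_ops_def scaleR_scaleC)
        finally have eq: "F (z + t *\<^sub>R x) = F z + t *\<^sub>R F x" .
        have "(norm (F (z + t *\<^sub>R x)))\<^sup>2 \<le> (norm (z + t *\<^sub>R x))\<^sup>2"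
          using Fn [OF Sr(1) [OF z(1) tx]] by (intro power_mono) auto
        then show ?thesis
          unfolding eq power2_norm_eq_inner using nz
          by (simp add: inner_simps inner_commute power2_eq_square algebra_simps)
      qed
      then have "inner z x - inner (F z) (F x) = 0" by (rule quadratic_nonneg_imp_linear_0)
      moreover have "inner (\<i> *\<^sub>C y) (\<i> *\<^sub>C W x) = inner z x"
        using A(2) [OF x y] by (simp add: inner_scaleC_left scaleC_scaleC z_def inner_commute)
      moreover have "inner (F z) (F x) = s * inner (\<i> *\<^sub>C y) (K x) + inner (\<i> *\<^sub>C y) (\<i> *\<^sub>C W x)"
        unfolding Fz by (simp add: F_def inner_add_right)
      ultimately have "s * inner (\<i> *\<^sub>C y) (K x) = 0" by simp
      then show ?thesis using s by simp
    qed
    \<comment> \<open>Chosen so that \<open>\<i> *\<^sub>C y\<close> becomes \<open>K x\<close>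
      itself.\<close>
    from this [of "(- \<i>) *\<^sub>C K x"] have "inner (K x) (K x) = 0"
      using Rr(2) [OF KR [OF x]] by (simp add: scaleC_scaleC)
    then show ?thesis by simp
  qed
qed

text \<open>In the application \<open>W\<close> is \<open>T22 + V T11 U\<close>, and
  \<open>s\<close>, \<open>c\<close> are sine and cosine. The sum of the two equations isolates
  \<open>W\<close>, their difference \<open>I - V U\<close>; the latter gives nothing if
  \<open>c = 0\<close>.\<close>

lemma parameters_average:
  fixes V :: "'a::complex_hilbert \<Rightarrow> 'b::complex_hilbert" and U :: "'b \<Rightarrow> 'a"
  assumes V: "V \<in> contractions UNIV UNIV" and U: "U \<in> contractions UNIV UNIV"
    and K1: "K1 \<in> contractions (defect_space U) (defect_space (cadjoint V))"
      "\<And>g. s *\<^sub>R W g + (\<i> * complex_of_real c) *\<^sub>C (g - V (U g)) = defect (cadjoint V) (K1 (defect U g))"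
    and K2: "K2 \<in> contractions (defect_space U) (defect_space (cadjoint V))"
      "\<And>g. s *\<^sub>R W g + (\<i> * complex_of_real (- c)) *\<^sub>C (g - V (U g)) = defect (cadjoint V) (K2 (defect U g))"
    and s: "s > 0"
  defines "K \<equiv> \<lambda>x. (1 / (2 * s)) *\<^sub>R (K1 x + K2 x)"
  shows "K \<in> bounded_ops (defect_space U) (defect_space (cadjoint V))"
    and "W g = defect (cadjoint V) (K (defect U g))"
    and "c \<noteq> 0 \<Longrightarrow> Q0_bounded V U"
    and "c \<noteq> 0 \<Longrightarrow> x \<in> defect_space U \<Longrightarrow> \<i> *\<^sub>C c *\<^sub>R Q_cl V U x = (1/2) *\<^sub>R (K1 x - K2 x)"
proof -
  note Vs = cadjoint_contraction [OF V]
  note H1 = defect_space [OF U] and H2 = defect_space [OF Vs]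
  note DVb = bounded_ops_UNIV [OF defect(1) [OF Vs]]
  note lD = bounded_linear.linear [OF DVb(1)]
  have b: "K1 \<in> bounded_ops (defect_space U) (defect_space (cadjoint V))"
    "K2 \<in> bounded_ops (defect_space U) (defect_space (cadjoint V))"
    using K1 K2 by (auto simp: contractions_def)
  show "K \<in> bounded_ops (defect_space U) (defect_space (cadjoint V))"
    unfolding K_def by (intro bounded_ops_scaleR bounded_ops_add H1 H2 b)
  have "defect (cadjoint V) (K1 (defect U g) + K2 (defect U g)) = (2 * s) *\<^sub>R W g" for g
    unfolding linear_add [OF lD] K1(2) [symmetric] K2(2) [symmetric]
    by (simp add: scaleC_minus_left scaleR_left_distrib scaleR_2 [symmetric])
  then show "W g = defect (cadjoint V) (K (defect U g))"
    using s by (simp add: K_def linear_scale [OF lD])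
  assume c: "c \<noteq> 0"
  \<comment> \<open>The difference of the equations carries the factor \<open>2 \<i> c\<close> on
    \<open>I - V U\<close>; the scalar is its inverse.\<close>
  define Q where "Q x = (- \<i> / complex_of_real (2 * c)) *\<^sub>C (K1 x - K2 x)" for x
  have Q: "Q \<in> bounded_ops (defect_space U) (defect_space (cadjoint V))"
    unfolding Q_def by (intro bounded_ops_scaleC bounded_ops_diff H1 H2 b)
  have fact: "x - V (U x) = defect (cadjoint V) (Q (defect U x))" for x
  proof -
    have "defect (cadjoint V) (K1 (defect U x) - K2 (defect U x))
        = (\<i> * complex_of_real c + \<i> * complex_of_real c) *\<^sub>C (x - V (U x))"
      unfolding linear_diff [OF lD] K1(2) [symmetric] K2(2) [symmetric]
      by (simp only: of_real_minus mult_minus_right scaleC_minus_left scaleC_add_left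
          add_diff_cancel_left diff_minus_eq_add)
    then show ?thesis
      using c by (simp add: Q_def DVb(2) scaleC_scaleC)
  qed
  show "Q0_bounded V U" using Q fact by (auto simp: Q0_bounded_def)
  show "\<i> *\<^sub>C c *\<^sub>R Q_cl V U x = (1/2) *\<^sub>R (K1 x - K2 x)" if "x \<in> defect_space U"
    unfolding Q_cl_eq [OF V U Q fact that] using c
    by (simp add: Q_def scaleR_scaleC scaleC_scaleC)
qed

theorem theorem3p4:
  fixes T1 T2 :: "'a::{complex_hilbert, second_countable_topology} \<Rightarrow>
                    'a \<times> 'b::{complex_hilbert, second_countable_topology}"
    and T11 :: "'a \<Rightarrow> 'a" and T12 U :: "'b \<Rightarrow> 'a" and T21 V :: "'a \<Rightarrow> 'b"
    and \<phi> :: real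
  assumes dual: "dual_pair T1 T2"
    and T11: "T11 \<in> bounded_ops UNIV UNIV" "cadjoint T11 = T11"
    and T12: "T12 \<in> bounded_ops UNIV UNIV"
    and T21: "T21 \<in> bounded_ops UNIV UNIV"
    and T1: "\<And>f. T1 f = (T11 f, T21 f)"
    and T2: "\<And>f. T2 f = (T11 f, cadjoint T12 f)"
    and V: "V \<in> contractions UNIV UNIV" "\<And>f. T21 f = V (defect T11 f)"
           "op_kernel (defect T11) \<subseteq> op_kernel V"
    and U: "U \<in> contractions UNIV UNIV" "\<And>g. T12 g = defect T11 (U g)"
           "op_kernel (defect T11) \<subseteq> op_kernel (cadjoint U)"
    and \<phi>: "0 < \<phi>" "\<phi> \<le> pi / 2"
  shows "(Ext T1 T2 \<phi> \<noteq> {} \<longleftrightarrow> \<phi> \<in> {phi1 V U..pi / 2}) \<and>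
    (\<phi> \<in> {phi1 V U..pi / 2} \<longrightarrow>
      (\<forall>T22 \<in> bounded_ops UNIV UNIV.
        block_op T11 T12 T21 T22 \<in> Ext T1 T2 \<phi> \<longleftrightarrow>
        (\<exists>K \<in> bounded_ops (defect_space U) (defect_space (cadjoint V)).
          (\<lambda>x. sin \<phi> *\<^sub>R K x + \<i> *\<^sub>C Q_cos V U \<phi> x)
            \<in> contractions (defect_space U) (defect_space (cadjoint V)) \<and>
          (\<lambda>x. sin \<phi> *\<^sub>R K x - \<i> *\<^sub>C Q_cos V U \<phi> x)
            \<in> contractions (defect_space U) (defect_space (cadjoint V)) \<and>
          (\<forall>g. T22 g = - V (T11 (U g)) + defect (cadjoint V) (K (defect U g)))))) \<and>
    (\<phi> \<in> {phi1 V U..pi / 2} \<longrightarrow>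
      (\<forall>g. defect (cadjoint V) g = 0) \<or> (\<forall>g. defect U g = 0) \<or>
      maximal_partial_isometry (defect_space U) (defect_space (cadjoint V)) (Q_cos V U \<phi>) \<longrightarrow>
      (\<exists>!T. T \<in> Ext T1 T2 \<phi>))"
proof -
  let ?H1 = "defect_space U" and ?H2 = "defect_space (cadjoint V)"
  let ?W = "\<lambda>T22 g. T22 g + V (T11 (U g))"
  \<comment> \<open>\<open>par\<close> records a contractive parameter for one sign of the shift,
    \<open>good\<close> a parameter as in the second assertion; the proof passes between a pair of
    the former and one of the latter.\<close>
  define par where "par T22 \<kappa> K \<longleftrightarrow> K \<in> contractions ?H1 ?H2 \<and>
    (\<forall>g. sin \<phi> *\<^sub>R ?W T22 g + (\<i> * complex_of_real \<kappa>) *\<^sub>C (g - V (U g))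
        = defect (cadjoint V) (K (defect U g)))" for T22 \<kappa> K
  define good where "good T22 K \<longleftrightarrow> K \<in> bounded_ops ?H1 ?H2 \<and>
    (\<lambda>x. sin \<phi> *\<^sub>R K x + \<i> *\<^sub>C Q_cos V U \<phi> x) \<in> contractions ?H1 ?H2 \<and>
    (\<lambda>x. sin \<phi> *\<^sub>R K x - \<i> *\<^sub>C Q_cos V U \<phi> x) \<in> contractions ?H1 ?H2 \<and>
    (\<forall>g. T22 g = - V (T11 (U g)) + defect (cadjoint V) (K (defect U g)))" for T22 K
  note Vs = cadjoint_contraction [OF V(1)]
  note H1 = defect_space [OF U(1)] and H2 = defect_space [OF Vs]
  note DVb = bounded_ops_UNIV [OF defect(1) [OF Vs]]
  note lD = bounded_linear.linear [OF DVb(1)]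
  have s: "sin \<phi> > 0" using \<phi> pi_gt_zero by (intro sin_gt_zero) linarith+
  have sc: "(sin \<phi>)\<^sup>2 + (cos \<phi>)\<^sup>2 = 1" and c: "cos \<phi> \<ge> 0"
    using \<phi> by (auto intro: cos_ge_zero)
  have T11c: "T11 \<in> contractions UNIV UNIV"
  proof -
    have "norm (T11 f) \<le> norm f" for f
    proof -
      have "norm (T11 f) \<le> norm (T1 f)" using norm_fst_le [of "T11 f" "T21 f"] by (simp add: T1)
      also have "\<dots> \<le> norm f" using dual by (auto simp: dual_pair_def contractions_def)
      finally show ?thesis .
    qed
    then show ?thesis using T11(1) by (simp add: contractions_def)
  qed
  have ext: "T \<in> extensions T1 T2 \<longleftrightarrow> (\<exists>T22\<in>bounded_ops UNIV UNIV. T = block_op T11 T12 T21 T22)" for T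
    by (rule extensions_iff [OF T11 T12 T21 T1 T2])
  have blk: "block_op T11 T12 T21 T22 \<in> Ext T1 T2 \<phi> \<longleftrightarrow> (\<exists>K. par T22 (cos \<phi>) K) \<and> (\<exists>K. par T22 (- cos \<phi>) K)"
    if T22: "T22 \<in> bounded_ops UNIV UNIV" for T22
  proof -
    have e: "block_op T11 T12 T21 T22 \<in> extensions T1 T2" using T22 ext by blast
    have "(\<forall>x. norm (sin \<phi> *\<^sub>R block_op T11 T12 T21 T22 x + (\<i> * complex_of_real \<kappa>) *\<^sub>C x) \<le> norm x)
        \<longleftrightarrow> (\<exists>K. par T22 \<kappa> K)" if "\<kappa> \<in> {cos \<phi>, - cos \<phi>}" for \<kappa>
      unfolding par_def using that s sc
      by (subst shifted_block_contraction_iff [OF T11c T11(2) U(2) V(2) V(1,3) U(1,3) T22]) auto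
    then have "block_op T11 T12 T21 T22 \<in> C_class \<phi> \<longleftrightarrow> (\<forall>\<kappa>\<in>{cos \<phi>, - cos \<phi>}. \<exists>K. par T22 \<kappa> K)"
      unfolding C_class_iff [OF block_op_bounded_ops [OF T11(1) T12 T21 T22]]
      by (intro ball_cong refl)
    then show ?thesis using e by (simp add: Ext_def)
  qed
  have phi: "\<phi> \<in> {phi1 V U..pi / 2} \<longleftrightarrow> cos \<phi> = 0 \<or>
    Q0_bounded V U \<and> (\<forall>x\<in>?H1. cos \<phi> * norm (Q_cl V U x) \<le> norm x)"
    using phi1_le_iff [OF V(1) U(1) \<phi>] \<phi> by simp
  have Z: "(\<lambda>x. 0) \<in> bounded_ops ?H1 ?H2"
    using complex_subspaceD(3) [OF H2(1)] by (auto simp: bounded_ops_def intro: exI [of _ 0])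
  \<comment> \<open>The angle condition and a parameter come out of the same pair \<open>K1\<close>,
    \<open>K2\<close>, which serves the first two assertions at once.\<close>
  have necessary: "\<phi> \<in> {phi1 V U..pi / 2} \<and> (\<exists>K. good T22 K)"
    if T22: "T22 \<in> bounded_ops UNIV UNIV" "block_op T11 T12 T21 T22 \<in> Ext T1 T2 \<phi>" for T22
  proof -
    obtain K1 K2 where K: "par T22 (cos \<phi>) K1" "par T22 (- cos \<phi>) K2"
      using blk T22 by blast
    have n: "norm (K1 x) \<le> norm x" "norm (K2 x) \<le> norm x" if "x \<in> ?H1" for x
      using K that by (auto simp: par_def contractions_def)
    define K where "K = (\<lambda>x. (1 / (2 * sin \<phi>)) *\<^sub>R (K1 x + K2 x))"
    have K1: "K1 \<in> contractions ?H1 ?H2"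
      "\<And>g. sin \<phi> *\<^sub>R ?W T22 g + (\<i> * complex_of_real (cos \<phi>)) *\<^sub>C (g - V (U g))
        = defect (cadjoint V) (K1 (defect U g))"
      using K(1) by (auto simp: par_def)
    have K2: "K2 \<in> contractions ?H1 ?H2"
      "\<And>g. sin \<phi> *\<^sub>R ?W T22 g + (\<i> * complex_of_real (- cos \<phi>)) *\<^sub>C (g - V (U g))
        = defect (cadjoint V) (K2 (defect U g))"
      using K(2) unfolding par_def by blast+
    note av = parameters_average [OF V(1) U(1) K1 K2 s]
    have WK: "?W T22 g = defect (cadjoint V) (K (defect U g))" for g
      unfolding K_def by (rule av(2))
    have Kb: "K \<in> bounded_ops ?H1 ?H2"
      unfolding K_def by (rule av(1))
    have mean: "norm ((1/2) *\<^sub>R (K1 x + K2 x)) \<le> norm x" "norm ((1/2) *\<^sub>R (K1 x - K2 x)) \<le> norm x"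
      if "x \<in> ?H1" for x
      using n [OF that] norm_triangle_ineq [of "K1 x" "K2 x"] norm_triangle_ineq4 [of "K1 x" "K2 x"]
      by auto
    have "cos \<phi> * norm (Q_cl V U x) \<le> norm x" if "cos \<phi> \<noteq> 0" "x \<in> ?H1" for x
    proof -
      have "cos \<phi> * norm (Q_cl V U x) = norm (\<i> *\<^sub>C cos \<phi> *\<^sub>R Q_cl V U x)"
        using c by (simp add: norm_scaleC)
      then show ?thesis using av(4) [OF that] mean(2) [OF that(2)] by simp
    qed
    then have "\<phi> \<in> {phi1 V U..pi / 2}" using phi av(3) by blast
    moreover have "good T22 K"
    proof -
      have sK: "sin \<phi> *\<^sub>R K x = (1/2) *\<^sub>R (K1 x + K2 x)" for x
        using s by (simp add: K_def)
      have Qb: "(\<lambda>x. \<i> *\<^sub>C Q_cos V U \<phi> x) \<in> bounded_ops ?H1 ?H2"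
      proof (cases "cos \<phi> = 0")
        case True
        then show ?thesis using Z by (simp add: Q_cos_def)
      next
        case False
        then show ?thesis
          unfolding Q_cos_def
          by (intro bounded_ops_scaleC bounded_ops_scaleR H2(1) Q_cl(1) [OF V(1) U(1)] av(3))
      qed
      \<comment> \<open>For nonzero cosine the two combinations are \<open>K1\<close> and
        \<open>K2\<close> themselves; for zero cosine both reduce to their mean.\<close>
      have b: "norm (sin \<phi> *\<^sub>R K x + \<i> *\<^sub>C Q_cos V U \<phi> x) \<le> norm x \<and>
          norm (sin \<phi> *\<^sub>R K x - \<i> *\<^sub>C Q_cos V U \<phi> x) \<le> norm x" if x: "x \<in> ?H1" for x
      proof (cases "cos \<phi> = 0")
        case True
        then show ?thesis unfolding sK using mean(1) [OF x] by (simp add: Q_cos_def)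
      next
        case False
        have "sin \<phi> *\<^sub>R K x + \<i> *\<^sub>C Q_cos V U \<phi> x = K1 x" "sin \<phi> *\<^sub>R K x - \<i> *\<^sub>C Q_cos V U \<phi> x = K2 x"
          unfolding Q_cos_def sK av(4) [OF False x]
          by (simp_all add: scaleR_add_right [symmetric] scaleR_diff_right [symmetric] scaleR_2 [symmetric])
        then show ?thesis using n [OF x] by simp
      qed
      have "T22 g = - V (T11 (U g)) + defect (cadjoint V) (K (defect U g))" for g
        by (simp add: WK [symmetric])
      then show ?thesis
        unfolding good_def contractions_def using Kb b Qb
        by (auto intro!: bounded_ops_add bounded_ops_diff bounded_ops_scaleR H1(1) H2(1))
    qed
    ultimately show ?thesis by blast
  qed
  \<comment> \<open>At zero cosine both sides vanish, so no factorization of \<open>I - V U\<close>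
    is called for.\<close>
  have factor: "(\<i> * complex_of_real (cos \<phi>)) *\<^sub>C (g - V (U g))
      = defect (cadjoint V) (\<i> *\<^sub>C Q_cos V U \<phi> (defect U g))"
    if "\<phi> \<in> {phi1 V U..pi / 2}" for g
  proof (cases "cos \<phi> = 0")
    case True
    then show ?thesis by (simp add: Q_cos_def linear_0 [OF lD])
  next
    case False
    then have "Q0_bounded V U" using that phi by blast
    then show ?thesis
      by (simp add: Q_cl(2) [OF V(1) U(1), of g] Q_cos_def DVb(2) scaleC_scaleC scaleR_scaleC)
  qed
  have sufficient: "block_op T11 T12 T21 T22 \<in> Ext T1 T2 \<phi>"
    if "\<phi> \<in> {phi1 V U..pi / 2}" "T22 \<in> bounded_ops UNIV UNIV" "good T22 K" for T22 K
  proof -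
    have W: "?W T22 g = defect (cadjoint V) (K (defect U g))" for g
      using that(3) by (simp add: good_def)
    have "par T22 (cos \<phi>) (\<lambda>x. sin \<phi> *\<^sub>R K x + \<i> *\<^sub>C Q_cos V U \<phi> x)"
      using that(3) unfolding par_def good_def W factor [OF that(1)]
      by (simp add: linear_add [OF lD] linear_scale [OF lD])
    moreover have "par T22 (- cos \<phi>) (\<lambda>x. sin \<phi> *\<^sub>R K x - \<i> *\<^sub>C Q_cos V U \<phi> x)"
      using that(3) factor [OF that(1)] unfolding par_def good_def W
      by (simp add: linear_diff [OF lD] linear_scale [OF lD] scaleC_minus_left)
    ultimately show ?thesis using blk [OF that(2)] by blast
  qed
  have VTU: "(\<lambda>g. - V (T11 (U g))) \<in> bounded_ops UNIV UNIV"
  proof -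
    have b: "V \<in> bounded_ops UNIV UNIV" "U \<in> bounded_ops UNIV UNIV"
      using V(1) U(1) by (simp_all add: contractions_def)
    have "(\<lambda>g. (- 1) *\<^sub>C V (T11 (U g))) \<in> bounded_ops UNIV UNIV"
      by (rule bounded_ops_scaleC [OF complex_subspace_UNIV
          bounded_ops_compose [OF b(1) bounded_ops_compose [OF T11(1) b(2)]]])
    then show ?thesis by simp
  qed
  \<comment> \<open>With the parameter \<open>K = 0\<close> only unimodular multiples of
    \<open>Q_cos\<close> have to be contractions, which is the angle condition; at zero cosine
    \<open>Q_cos\<close> is zero whatever \<open>Q_cl\<close> is.\<close>
  have nonempty: "block_op T11 T12 T21 (\<lambda>g. - V (T11 (U g))) \<in> Ext T1 T2 \<phi>"
    if "\<phi> \<in> {phi1 V U..pi / 2}"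
  proof -
    have Qc: "(\<lambda>x. a *\<^sub>C Q_cos V U \<phi> x) \<in> contractions ?H1 ?H2" if a: "cmod a = 1" for a
    proof (cases "cos \<phi> = 0")
      case True
      then show ?thesis using Z by (simp add: Q_cos_def contractions_def)
    next
      case False
      then have Q: "Q0_bounded V U" "\<And>x. x \<in> ?H1 \<Longrightarrow> cos \<phi> * norm (Q_cl V U x) \<le> norm x"
        using \<open>\<phi> \<in> _\<close> phi by blast+
      show ?thesis
        unfolding contractions_def
      proof (intro CollectI conjI ballI)
        show "(\<lambda>x. a *\<^sub>C Q_cos V U \<phi> x) \<in> bounded_ops ?H1 ?H2"
          unfolding Q_cos_def
          by (intro bounded_ops_scaleC bounded_ops_scaleR H2(1) Q_cl(1) [OF V(1) U(1) Q(1)])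
        show "norm (a *\<^sub>C Q_cos V U \<phi> x) \<le> norm x" if "x \<in> ?H1" for x
          using Q(2) [OF that] a c by (simp add: Q_cos_def norm_scaleC)
      qed
    qed
    have "good (\<lambda>g. - V (T11 (U g))) (\<lambda>x. 0)"
      unfolding good_def using Z Qc [of \<i>] Qc [of "- \<i>"]
      by (simp add: linear_0 [OF lD] scaleC_minus_left)
    then show ?thesis using sufficient that VTU by blast
  qed
  have i: "Ext T1 T2 \<phi> \<noteq> {} \<longleftrightarrow> \<phi> \<in> {phi1 V U..pi / 2}"
  proof
    assume "Ext T1 T2 \<phi> \<noteq> {}"
    then obtain T where T: "T \<in> Ext T1 T2 \<phi>" by blast
    then obtain T22 where "T22 \<in> bounded_ops UNIV UNIV" "T = block_op T11 T12 T21 T22"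
      using ext by (auto simp: Ext_def)
    then show "\<phi> \<in> {phi1 V U..pi / 2}" using necessary T by blast
  next
    show "Ext T1 T2 \<phi> \<noteq> {}" if "\<phi> \<in> {phi1 V U..pi / 2}" using nonempty [OF that] by blast
  qed
  have ii: "block_op T11 T12 T21 T22 \<in> Ext T1 T2 \<phi> \<longleftrightarrow> (\<exists>K. good T22 K)"
    if "\<phi> \<in> {phi1 V U..pi / 2}" "T22 \<in> bounded_ops UNIV UNIV" for T22
    using necessary sufficient that by blast
  have iii: "\<exists>!T. T \<in> Ext T1 T2 \<phi>"
    if \<phi>1: "\<phi> \<in> {phi1 V U..pi / 2}" and deg: "(\<forall>g. defect (cadjoint V) g = 0) \<or> (\<forall>g. defect U g = 0) \<or>
      maximal_partial_isometry ?H1 ?H2 (Q_cos V U \<phi>)"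
  proof (rule ex1I)
    show "block_op T11 T12 T21 (\<lambda>g. - V (T11 (U g))) \<in> Ext T1 T2 \<phi>"
      by (rule nonempty [OF \<phi>1])
    fix T assume T: "T \<in> Ext T1 T2 \<phi>"
    then obtain T22 where T22: "T22 \<in> bounded_ops UNIV UNIV" "T = block_op T11 T12 T21 T22"
      using ext by (auto simp: Ext_def)
    then obtain K where K: "good T22 K" using necessary T by blast
    \<comment> \<open>In each degenerate case the parameter leaves no trace in \<open>T22\<close>,
      so every extension coincides with the one from \<open>nonempty\<close>.\<close>
    have "defect (cadjoint V) (K (defect U g)) = 0" for g
      using deg
    proof (elim disjE)
      assume "\<forall>g. defect U g = 0"
      moreover have "K 0 = 0"
      proof -
        obtain C where "\<And>x. x \<in> ?H1 \<Longrightarrow> norm (K x) \<le> C * norm x"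
          using K bounded_ops_bound unfolding good_def by blast
        from this [OF complex_subspaceD(3) [OF H1(1)]] show ?thesis by simp
      qed
      ultimately show ?thesis by (simp add: linear_0 [OF lD])
    next
      assume "maximal_partial_isometry ?H1 ?H2 (Q_cos V U \<phi>)"
      then have "K (defect U g) = 0"
        using K s H1(3) unfolding good_def
        by (intro maximal_partial_isometry_rigid [OF H1(1,2) H2(1)]) auto
      then show ?thesis by (simp add: linear_0 [OF lD])
    qed auto
    then have "T22 = (\<lambda>g. - V (T11 (U g)))"
      using K by (auto simp: good_def)
    then show "T = block_op T11 T12 T21 (\<lambda>g. - V (T11 (U g)))" using T22 by simp
  qed
  show ?thesis
    using i ii iii unfolding good_def Bex_def by blast
qed

end
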